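(* Let $X$ and $Y$ be doubly-degenerate $\mathbf{Bicat}_s$-categories and let $(F,v)$ be a (weak) monoidal functor $X\to Y$ with respect to the vertical tensor products, satisfying the braid axiom $$F(\gamma_{a,b})\circ v_{a,b}=v_{b,a}\circ\gamma_{Fa,Fb}\qquad\text{for all } a,b\in X .$$ Then defining $h$ by $$h_{a,b}\;=\;F(\alpha_{a,b})^{-1}\circ v_{a,b}\circ\alpha_{Fa,Fb}\colon\ Fa\,|\,Fb\longrightarrow F(a\,|\,b)$$ makes $F$ (with $v$, $h$ and the unit constraint of $(F,v)$) into a weak map of doubly-degenerate $\mathbf{Bicat}_s$-categories.
   Context: **Doubly-degenerate $\mathbf{Bicat}_s$-categories.** $\mathbf{Bicat}_s$ is the category of bicategories and strict functors (cartesian monoidal). A doubly-degenerate $\mathbf{Bicat}_s$-category is a $\mathbf{Bicat}_s$-enriched category with exactly one 0-cell and exactly one 1-cell. Equivalently, it is a category $X$ with: - a weak (vertical) monoidal structure with tensor $\frac{a}{b}$, unit $1$, and unit isomorphisms $\tau_a\colon\frac{1}{a}\to a$, $\beta_a\colon\frac{a}{1}\to a$; - a strict (horizontal) monoidal structure with tensor $a\,|\,b$ and the same unit $1$; such that $|\colon X\times X\to X$ and the unit $\mathbf 1\to X$ are strict monoidal functors for the vertical structure. In particular $\frac{a|b}{c|d}=\frac{a}{c}\big|\frac{b}{d}$ strictly. **The maps $\alpha$, $\overline\alpha$, $\gamma$.** Define natural isomorphisms $$\alpha_{a,b}\colon a|b \xrightarrow{\ \beta_a^{-1}|\tau_b^{-1}\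 } \tfrac{a}{1}\big|\tfrac{1}{b}=\tfrac{a|1}{1|b}=\tfrac{a}{b},\qquad \overline{\alpha}_{a,b}\colon a|b \xrightarrow{\ \tau_a^{-1}|\beta_b^{-1}\ } \tfrac{1}{a}\big|\tfrac{b}{1}=\tfrac{1|b}{a|1}=\tfrac{b}{a},$$ and the standard braiding $\gamma_{a,b}=\alpha_{b,a}\circ\overline{\alpha}_{b,a}^{-1}\colon\frac{a}{b}\to\frac{b}{a}$. It is known that this makes the vertical monoidal structure braided. A (weak) monoidal functor $(F,v)$ has invertible natural constraints $v_{a,b}\colon\frac{Fa}{Fb}\to F(\frac{a}{b})$ and an invertible unit constraint $\eta\colon1\to F1$ satisfying the usual axioms. **Weak maps.** A weak map $X\to Y$ of doubly-degenerate $\mathbf{Bicat}_s$-categories is a functor $F$ with natural isomorphisms $v_{a,b}\colon\frac{Fa}{Fb}\to F(\frac{a}{b})$ and $h_{a,b}\colon Fa|Fb\to F(a|b)$ and an isomorphism $\eta\colon1\to F1$ such that $(F,v,\eta)$ and $(F,h,\eta)$ are monoidal functors for the vertical and horizontal structures respectively, and $v_{a|b,c|d}\circ\frac{h_{a,b}}{h_{c,d}}=h_{\frac{a}{c},\frac{b}{d}}\circ(v_{a,c}|v_{b,d})$ for all $a,b,c,d$ (the interaction axiom). *)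

theory Defs
  imports Main
begin

section \<open>Categories, functors and natural isomorphisms\<close>

text \<open>
  Categories are records of objects and arrows; the fields are only meaningful on
  \<open>Obj\<close> and \<open>Arr\<close>. In infix notation, index \<open>0\<close> marks an operation on
  objects and index \<open>1\<close> the corresponding operation on arrows. Composition
  \<open>g \<cdot> f\<close> is in applicative order.
\<close>

record ('o, 'm) cat =
  Obj :: "'o set"
  Arr :: "'m set"
  Dom :: "'m \<Rightarrow> 'o"
  Cod :: "'m \<Rightarrow> 'o"
  Ide :: "'o \<Rightarrow> 'm"
  Comp :: "'m \<Rightarrow> 'm \<Rightarrow> 'm"  (infixr \<open>\<cdot>\<index>\<close> 55)

definition hom :: "('o, 'm, 'z) cat_scheme \<Rightarrow> 'o \<Rightarrow> 'o \<Rightarrow> 'm set" where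
  "hom C a b = {f \<in> Arr C. Dom C f = a \<and> Cod C f = b}"

locale category =
  fixes C :: "('o, 'm, 'z) cat_scheme" (structure)
  assumes Dom_closed: "f \<in> Arr C \<Longrightarrow> Dom C f \<in> Obj C"
    and Cod_closed: "f \<in> Arr C \<Longrightarrow> Cod C f \<in> Obj C"
    and Ide_hom: "a \<in> Obj C \<Longrightarrow> Ide C a \<in> hom C a a"
    and Comp_hom: "\<lbrakk>f \<in> hom C a b; g \<in> hom C b c\<rbrakk> \<Longrightarrow> g \<cdot> f \<in> hom C a c"
    and Comp_Ide: "f \<in> hom C a b \<Longrightarrow> f \<cdot> Ide C a = f"
    and Ide_Comp: "f \<in> hom C a b \<Longrightarrow> Ide C b \<cdot> f = f"
    and Comp_assoc: "\<lbrakk>f \<in> hom C a b; g \<in> hom C b c; k \<in> hom C c d\<rbrakk>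
          \<Longrightarrow> (k \<cdot> g) \<cdot> f = k \<cdot> (g \<cdot> f)"

definition inverse_arrows :: "('o, 'm, 'z) cat_scheme \<Rightarrow> 'm \<Rightarrow> 'm \<Rightarrow> bool" where
  "inverse_arrows C f g \<longleftrightarrow>
     f \<in> Arr C \<and> g \<in> hom C (Cod C f) (Dom C f) \<and>
     g \<cdot>\<^bsub>C\<^esub> f = Ide C (Dom C f) \<and> f \<cdot>\<^bsub>C\<^esub> g = Ide C (Cod C f)"

definition isos :: "('o, 'm, 'z) cat_scheme \<Rightarrow> 'o \<Rightarrow> 'o \<Rightarrow> 'm set" where
  "isos C a b = {f \<in> hom C a b. \<exists>g. inverse_arrows C f g}"

definition inv_arr :: "('o, 'm, 'z) cat_scheme \<Rightarrow> 'm \<Rightarrow> 'm" where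
  "inv_arr C f = (THE g. inverse_arrows C f g)"

record ('o1, 'm1, 'o2, 'm2) functor_data =
  OMap :: "'o1 \<Rightarrow> 'o2"
  AMap :: "'m1 \<Rightarrow> 'm2"

locale cat_functor = dom: category C + cod: category D
  for C :: "('o1, 'm1, 'y) cat_scheme" and D :: "('o2, 'm2, 'z) cat_scheme" +
  fixes F :: "('o1, 'm1, 'o2, 'm2) functor_data"
  assumes OMap_closed: "a \<in> Obj C \<Longrightarrow> OMap F a \<in> Obj D"
    and AMap_hom: "f \<in> hom C a b \<Longrightarrow> AMap F f \<in> hom D (OMap F a) (OMap F b)"
    and AMap_Ide: "a \<in> Obj C \<Longrightarrow> AMap F (Ide C a) = Ide D (OMap F a)"
    and AMap_Comp: "\<lbrakk>f \<in> hom C a b; g \<in> hom C b c\<rbrakk>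
          \<Longrightarrow> AMap F (g \<cdot>\<^bsub>C\<^esub> f) = AMap F g \<cdot>\<^bsub>D\<^esub> AMap F f"

locale natural_iso = F: cat_functor C D F + G: cat_functor C D G
  for C :: "('o1, 'm1, 'y) cat_scheme" and D :: "('o2, 'm2, 'z) cat_scheme"
    and F G :: "('o1, 'm1, 'o2, 'm2) functor_data" +
  fixes t :: "'o1 \<Rightarrow> 'm2"
  assumes component_iso: "a \<in> Obj C \<Longrightarrow> t a \<in> isos D (OMap F a) (OMap G a)"
    and naturality: "f \<in> hom C a b \<Longrightarrow> t b \<cdot>\<^bsub>D\<^esub> AMap F f = AMap G f \<cdot>\<^bsub>D\<^esub> t a"

definition prod_cat ::
  "('o1, 'm1, 'y) cat_scheme \<Rightarrow> ('o2, 'm2, 'z) cat_scheme \<Rightarrow> ('o1 \<times> 'o2, 'm1 \<times> 'm2) cat"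
where
  "prod_cat C D =
    \<lparr>Obj = Obj C \<times> Obj D,
     Arr = Arr C \<times> Arr D,
     Dom = map_prod (Dom C) (Dom D),
     Cod = map_prod (Cod C) (Cod D),
     Ide = map_prod (Ide C) (Ide D),
     Comp = (\<lambda>(g, g') (f, f'). (g \<cdot>\<^bsub>C\<^esub> f, g' \<cdot>\<^bsub>D\<^esub> f'))\<rparr>"


section \<open>Monoidal categories\<close>

record ('o, 'm) moncat = "('o, 'm) cat" +
  TensO :: "'o \<Rightarrow> 'o \<Rightarrow> 'o"  (infixr \<open>\<otimes>\<^sub>0\<index>\<close> 70)
  TensA :: "'m \<Rightarrow> 'm \<Rightarrow> 'm"  (infixr \<open>\<otimes>\<^sub>1\<index>\<close> 70)
  UnitO :: "'o"  (\<open>\<one>\<index>\<close>)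
  Assoc :: "'o \<Rightarrow> 'o \<Rightarrow> 'o \<Rightarrow> 'm"
  LUnit :: "'o \<Rightarrow> 'm"
  RUnit :: "'o \<Rightarrow> 'm"

locale monoidal_category = category M
  for M :: "('o, 'm, 'z) moncat_scheme" (structure) +
  assumes tensor_functor:
      "cat_functor (prod_cat M M) M
         \<lparr>OMap = \<lambda>(a, b). a \<otimes>\<^sub>0 b, AMap = \<lambda>(f, g). f \<otimes>\<^sub>1 g\<rparr>"
    and UnitO_closed: "\<one> \<in> Obj M"
    and Assoc_natural:
      "natural_iso (prod_cat M (prod_cat M M)) M
         \<lparr>OMap = \<lambda>(a, b, c). (a \<otimes>\<^sub>0 b) \<otimes>\<^sub>0 c, AMap = \<lambda>(f, g, k). (f \<otimes>\<^sub>1 g) \<otimes>\<^sub>1 k\<rparr>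
         \<lparr>OMap = \<lambda>(a, b, c). a \<otimes>\<^sub>0 (b \<otimes>\<^sub>0 c), AMap = \<lambda>(f, g, k). f \<otimes>\<^sub>1 (g \<otimes>\<^sub>1 k)\<rparr>
         (\<lambda>(a, b, c). Assoc M a b c)"
    and LUnit_natural:
      "natural_iso M M
         \<lparr>OMap = \<lambda>a. \<one> \<otimes>\<^sub>0 a, AMap = \<lambda>f. Ide M \<one> \<otimes>\<^sub>1 f\<rparr>
         \<lparr>OMap = \<lambda>a. a, AMap = \<lambda>f. f\<rparr>
         (LUnit M)"
    and RUnit_natural:
      "natural_iso M M
         \<lparr>OMap = \<lambda>a. a \<otimes>\<^sub>0 \<one>, AMap = \<lambda>f. f \<otimes>\<^sub>1 Ide M \<one>\<rparr>
         \<lparr>OMap = \<lambda>a. a, AMap = \<lambda>f. f\<rparr>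
         (RUnit M)"
    and pentagon:
      "\<lbrakk>a \<in> Obj M; b \<in> Obj M; c \<in> Obj M; d \<in> Obj M\<rbrakk> \<Longrightarrow>
         Assoc M a b (c \<otimes>\<^sub>0 d) \<cdot> Assoc M (a \<otimes>\<^sub>0 b) c d =
         (Ide M a \<otimes>\<^sub>1 Assoc M b c d) \<cdot> Assoc M a (b \<otimes>\<^sub>0 c) d \<cdot> (Assoc M a b c \<otimes>\<^sub>1 Ide M d)"
    and triangle:
      "\<lbrakk>a \<in> Obj M; b \<in> Obj M\<rbrakk> \<Longrightarrow>
         (Ide M a \<otimes>\<^sub>1 LUnit M b) \<cdot> Assoc M a \<one> b = RUnit M a \<otimes>\<^sub>1 Ide M b"

locale strict_monoidal_category = monoidal_category +
  assumes strict_assoc: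
      "\<lbrakk>a \<in> Obj M; b \<in> Obj M; c \<in> Obj M\<rbrakk> \<Longrightarrow> (a \<otimes>\<^sub>0 b) \<otimes>\<^sub>0 c = a \<otimes>\<^sub>0 (b \<otimes>\<^sub>0 c)"
    and strict_lunit: "a \<in> Obj M \<Longrightarrow> \<one> \<otimes>\<^sub>0 a = a"
    and strict_runit: "a \<in> Obj M \<Longrightarrow> a \<otimes>\<^sub>0 \<one> = a"
    and Assoc_Ide:
      "\<lbrakk>a \<in> Obj M; b \<in> Obj M; c \<in> Obj M\<rbrakk> \<Longrightarrow> Assoc M a b c = Ide M (a \<otimes>\<^sub>0 (b \<otimes>\<^sub>0 c))"
    and LUnit_Ide: "a \<in> Obj M \<Longrightarrow> LUnit M a = Ide M a"
    and RUnit_Ide: "a \<in> Obj M \<Longrightarrow> RUnit M a = Ide M a"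

definition prod_moncat ::
  "('o1, 'm1, 'y) moncat_scheme \<Rightarrow> ('o2, 'm2, 'z) moncat_scheme
     \<Rightarrow> ('o1 \<times> 'o2, 'm1 \<times> 'm2) moncat"
where
  "prod_moncat M N = cat.extend (prod_cat M N)
    (moncat.fields
      (\<lambda>(a, a') (b, b'). (a \<otimes>\<^sub>0\<^bsub>M\<^esub> b, a' \<otimes>\<^sub>0\<^bsub>N\<^esub> b'))
      (\<lambda>(f, f') (g, g'). (f \<otimes>\<^sub>1\<^bsub>M\<^esub> g, f' \<otimes>\<^sub>1\<^bsub>N\<^esub> g'))
      (\<one>\<^bsub>M\<^esub>, \<one>\<^bsub>N\<^esub>)
      (\<lambda>(a, a') (b, b') (c, c'). (Assoc M a b c, Assoc N a' b' c'))
      (\<lambda>(a, a'). (LUnit M a, LUnit N a'))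
      (\<lambda>(a, a'). (RUnit M a, RUnit N a')))"

definition terminal_moncat :: "(unit, unit) moncat" where
  "terminal_moncat =
    \<lparr>Obj = UNIV, Arr = UNIV, Dom = \<lambda>_. (), Cod = \<lambda>_. (), Ide = \<lambda>_. (), Comp = \<lambda>_ _. (),
     TensO = \<lambda>_ _. (), TensA = \<lambda>_ _. (), UnitO = (),
     Assoc = \<lambda>_ _ _. (), LUnit = \<lambda>_. (), RUnit = \<lambda>_. ()\<rparr>"


section \<open>Monoidal functors\<close>

locale monoidal_functor =
  cat_functor M N F + dom: monoidal_category M + cod: monoidal_category N
  for M :: "('o1, 'm1, 'y) moncat_scheme" and N :: "('o2, 'm2, 'z) moncat_scheme"
    and F :: "('o1, 'm1, 'o2, 'm2) functor_data" +
  fixes v :: "'o1 \<Rightarrow> 'o1 \<Rightarrow> 'm2" and \<eta> :: "'m2"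
  assumes constraint_natural:
      "natural_iso (prod_cat M M) N
         \<lparr>OMap = \<lambda>(a, b). OMap F a \<otimes>\<^sub>0\<^bsub>N\<^esub> OMap F b,
          AMap = \<lambda>(f, g). AMap F f \<otimes>\<^sub>1\<^bsub>N\<^esub> AMap F g\<rparr>
         \<lparr>OMap = \<lambda>(a, b). OMap F (a \<otimes>\<^sub>0\<^bsub>M\<^esub> b),
          AMap = \<lambda>(f, g). AMap F (f \<otimes>\<^sub>1\<^bsub>M\<^esub> g)\<rparr>
         (\<lambda>(a, b). v a b)"
    and unit_constraint_iso: "\<eta> \<in> isos N \<one>\<^bsub>N\<^esub> (OMap F \<one>\<^bsub>M\<^esub>)"
    and constraint_assoc:
      "\<lbrakk>a \<in> Obj M; b \<in> Obj M; c \<in> Obj M\<rbrakk> \<Longrightarrow>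
         AMap F (Assoc M a b c) \<cdot>\<^bsub>N\<^esub> v (a \<otimes>\<^sub>0\<^bsub>M\<^esub> b) c \<cdot>\<^bsub>N\<^esub> (v a b \<otimes>\<^sub>1\<^bsub>N\<^esub> Ide N (OMap F c)) =
         v a (b \<otimes>\<^sub>0\<^bsub>M\<^esub> c) \<cdot>\<^bsub>N\<^esub> (Ide N (OMap F a) \<otimes>\<^sub>1\<^bsub>N\<^esub> v b c)
           \<cdot>\<^bsub>N\<^esub> Assoc N (OMap F a) (OMap F b) (OMap F c)"
    and constraint_lunit:
      "a \<in> Obj M \<Longrightarrow>
         AMap F (LUnit M a) \<cdot>\<^bsub>N\<^esub> v \<one>\<^bsub>M\<^esub> a \<cdot>\<^bsub>N\<^esub> (\<eta> \<otimes>\<^sub>1\<^bsub>N\<^esub> Ide N (OMap F a)) = LUnit N (OMap F a)"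
    and constraint_runit:
      "a \<in> Obj M \<Longrightarrow>
         AMap F (RUnit M a) \<cdot>\<^bsub>N\<^esub> v a \<one>\<^bsub>M\<^esub> \<cdot>\<^bsub>N\<^esub> (Ide N (OMap F a) \<otimes>\<^sub>1\<^bsub>N\<^esub> \<eta>) = RUnit N (OMap F a)"

locale strict_monoidal_functor =
  cat_functor M N F + dom: monoidal_category M + cod: monoidal_category N
  for M :: "('o1, 'm1, 'y) moncat_scheme" and N :: "('o2, 'm2, 'z) moncat_scheme"
    and F :: "('o1, 'm1, 'o2, 'm2) functor_data" +
  assumes OMap_tensor:
      "\<lbrakk>a \<in> Obj M; b \<in> Obj M\<rbrakk> \<Longrightarrow> OMap F (a \<otimes>\<^sub>0\<^bsub>M\<^esub> b) = OMap F a \<otimes>\<^sub>0\<^bsub>N\<^esub> OMap F b"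
    and AMap_tensor:
      "\<lbrakk>f \<in> Arr M; g \<in> Arr M\<rbrakk> \<Longrightarrow> AMap F (f \<otimes>\<^sub>1\<^bsub>M\<^esub> g) = AMap F f \<otimes>\<^sub>1\<^bsub>N\<^esub> AMap F g"
    and OMap_UnitO: "OMap F \<one>\<^bsub>M\<^esub> = \<one>\<^bsub>N\<^esub>"
    and AMap_Assoc:
      "\<lbrakk>a \<in> Obj M; b \<in> Obj M; c \<in> Obj M\<rbrakk> \<Longrightarrow>
         AMap F (Assoc M a b c) = Assoc N (OMap F a) (OMap F b) (OMap F c)"
    and AMap_LUnit: "a \<in> Obj M \<Longrightarrow> AMap F (LUnit M a) = LUnit N (OMap F a)"
    and AMap_RUnit: "a \<in> Obj M \<Longrightarrow> AMap F (RUnit M a) = RUnit N (OMap F a)"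


section \<open>Doubly-degenerate \<open>Bicat\<^sub>s\<close>-categories\<close>

text \<open>
  The fields inherited from \<^type>\<open>moncat\<close> are the vertical structure: \<open>a \<otimes>\<^sub>0 b\<close> is
  \<open>a\<close> over \<open>b\<close>, \<^const>\<open>LUnit\<close> is \<open>\<tau>\<close> and \<^const>\<open>RUnit\<close> is \<open>\<beta>\<close>. The horizontal tensor
  \<open>a | b\<close> is \<open>a \<parallel>\<^sub>0 b\<close>; it is strict and shares the vertical unit, so no further
  data is needed.
\<close>

record ('o, 'm) ddcat = "('o, 'm) moncat" +
  HorO :: "'o \<Rightarrow> 'o \<Rightarrow> 'o"  (infixr \<open>\<parallel>\<^sub>0\<index>\<close> 70)
  HorA :: "'m \<Rightarrow> 'm \<Rightarrow> 'm"  (infixr \<open>\<parallel>\<^sub>1\<index>\<close> 70)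

definition horizontal :: "('o, 'm, 'z) ddcat_scheme \<Rightarrow> ('o, 'm) moncat" where
  "horizontal X =
    \<lparr>Obj = Obj X, Arr = Arr X, Dom = Dom X, Cod = Cod X, Ide = Ide X, Comp = Comp X,
     TensO = HorO X, TensA = HorA X, UnitO = \<one>\<^bsub>X\<^esub>,
     Assoc = \<lambda>a b c. Ide X (a \<parallel>\<^sub>0\<^bsub>X\<^esub> (b \<parallel>\<^sub>0\<^bsub>X\<^esub> c)), LUnit = Ide X, RUnit = Ide X\<rparr>"

locale dd_Bicats_category = monoidal_category X
  for X :: "('o, 'm, 'z) ddcat_scheme" (structure) +
  assumes horizontal_strict: "strict_monoidal_category (horizontal X)"
    and hor_tensor_strict:
      "strict_monoidal_functor (prod_moncat X X) X
         \<lparr>OMap = \<lambda>(a, b). a \<parallel>\<^sub>0 b, AMap = \<lambda>(f, g). f \<parallel>\<^sub>1 g\<rparr>"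
    and hor_unit_strict:
      "strict_monoidal_functor terminal_moncat X
         \<lparr>OMap = \<lambda>_. \<one>, AMap = \<lambda>_. Ide X \<one>\<rparr>"

text \<open>
  Interchange and strictness of the horizontal units give
  \<open>(a \<otimes>\<^sub>0 \<one>) \<parallel>\<^sub>0 (\<one> \<otimes>\<^sub>0 b) = (a \<parallel>\<^sub>0 \<one>) \<otimes>\<^sub>0 (\<one> \<parallel>\<^sub>0 b) = a \<otimes>\<^sub>0 b\<close> on the nose, so
  \<open>alpha X a b\<close> is an arrow from \<open>a \<parallel>\<^sub>0 b\<close> to \<open>a \<otimes>\<^sub>0 b\<close>; likewise
  \<open>alpha_bar X a b\<close> is an arrow from \<open>a \<parallel>\<^sub>0 b\<close> to \<open>b \<otimes>\<^sub>0 a\<close>.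
\<close>

definition alpha :: "('o, 'm, 'z) ddcat_scheme \<Rightarrow> 'o \<Rightarrow> 'o \<Rightarrow> 'm" where
  "alpha X a b = inv_arr X (RUnit X a) \<parallel>\<^sub>1\<^bsub>X\<^esub> inv_arr X (LUnit X b)"

definition alpha_bar :: "('o, 'm, 'z) ddcat_scheme \<Rightarrow> 'o \<Rightarrow> 'o \<Rightarrow> 'm" where
  "alpha_bar X a b = inv_arr X (LUnit X a) \<parallel>\<^sub>1\<^bsub>X\<^esub> inv_arr X (RUnit X b)"

definition braiding :: "('o, 'm, 'z) ddcat_scheme \<Rightarrow> 'o \<Rightarrow> 'o \<Rightarrow> 'm" where
  "braiding X a b = alpha X b a \<cdot>\<^bsub>X\<^esub> inv_arr X (alpha_bar X b a)"

locale weak_map =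
  dom: dd_Bicats_category X + cod: dd_Bicats_category Y +
  vertical: monoidal_functor X Y F v \<eta> +
  horizontal: monoidal_functor "horizontal X" "horizontal Y" F h \<eta>
  for X :: "('o1, 'm1, 'y) ddcat_scheme" and Y :: "('o2, 'm2, 'z) ddcat_scheme"
    and F :: "('o1, 'm1, 'o2, 'm2) functor_data"
    and v h :: "'o1 \<Rightarrow> 'o1 \<Rightarrow> 'm2" and \<eta> :: "'m2" +
  assumes interaction:
    "\<lbrakk>a \<in> Obj X; b \<in> Obj X; c \<in> Obj X; d \<in> Obj X\<rbrakk> \<Longrightarrow>
       v (a \<parallel>\<^sub>0\<^bsub>X\<^esub> b) (c \<parallel>\<^sub>0\<^bsub>X\<^esub> d) \<cdot>\<^bsub>Y\<^esub> (h a b \<otimes>\<^sub>1\<^bsub>Y\<^esub> h c d) =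
       h (a \<otimes>\<^sub>0\<^bsub>X\<^esub> c) (b \<otimes>\<^sub>0\<^bsub>X\<^esub> d) \<cdot>\<^bsub>Y\<^esub> (v a c \<parallel>\<^sub>1\<^bsub>Y\<^esub> v b d)"

end

theory Submission
  imports Defs
begin

text \<open>
  Write \<open>\<otimes>\<close> and \<open>|\<close> for the two tensors and \<open>\<sigma>\<^sub>a\<^sub>,\<^sub>b : a | b \<rightarrow> b | a\<close> for the composite of
  \<open>alpha\<close> with the inverse of \<open>alpha_bar\<close>; it is the braiding \<open>\<gamma>\<close> carried along \<open>alpha\<close> to the
  horizontal tensor. The maps \<open>alpha\<close> are natural and make the identity functor monoidal
  from \<open>|\<close> to \<open>\<otimes>\<close> (\<open>alpha_hexagon\<close>). The proposed \<open>h\<close> is \<open>v\<close> conjugated by \<open>alpha\<close>, that is, the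
  constraint of the composite monoidal functor \<open>(X, |) \<rightarrow> (X, \<otimes>) \<rightarrow> (Y, \<otimes>) \<rightarrow> (Y, |)\<close>; this is
  why it satisfies the horizontal axioms.

  The hexagon is an equation of threefold horizontal composites: since
  \<open>a \<otimes> b = (a \<otimes> \<one>) | (\<one> \<otimes> b)\<close> and the vertical constraints are strictly compatible with
  \<open>|\<close>, each of \<open>alpha\<close>, its inverse and the associator splits horizontally into constraints
  of single objects, where the triangle axiom and Kelly's unit lemma (\<open>LUnit_tensor\<close>)
  suffice.

  Interaction is an equation about interchange. In terms of \<open>v\<close> it would involve the middle
  four interchange for \<open>\<otimes>\<close>, with all its associators. Rewriting \<open>v\<close> through \<open>h\<close>
  moves everything to the strict tensor, where the difference between the two sides is a
  single swap of the middle factors,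
  \<open>alpha (a | b) (c | d) = (alpha a c | alpha b d) \<cdot> (a | \<sigma>\<^sub>b\<^sub>,\<^sub>c | d)\<close> (\<open>alpha_HorO\<close>).
  The braid axiom says that \<open>F\<close> with \<open>h\<close> preserves \<open>\<sigma>\<close> (\<open>h_hor_swap\<close>), and associativity of
  \<open>h\<close> lets the swap act in the middle of a fourfold product (\<open>h_middle_swap\<close>).
\<close>

section \<open>Composition and inverses\<close>

definition invertible_arrow :: "('o, 'm, 'z) cat_scheme \<Rightarrow> 'm \<Rightarrow> bool" where
  "invertible_arrow C f \<longleftrightarrow> (\<exists>g. inverse_arrows C f g)"

context category
begin

lemma Dom_Obj [simp]: "f \<in> Arr C \<Longrightarrow> Dom C f \<in> Obj C"
  by (rule Dom_closed)

lemma Cod_Obj [simp]: "f \<in> Arr C \<Longrightarrow> Cod C f \<in> Obj C"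
  by (rule Cod_closed)

lemma Ide_Arr [simp]:
  assumes "a \<in> Obj C"
  shows "Ide C a \<in> Arr C" and "Dom C (Ide C a) = a" and "Cod C (Ide C a) = a"
  using Ide_hom[OF assms] by (auto simp: hom_def)

lemma Comp_Arr [simp]:
  assumes "f \<in> Arr C" "g \<in> Arr C" "Dom C g = Cod C f"
  shows "g \<cdot> f \<in> Arr C" and "Dom C (g \<cdot> f) = Dom C f" and "Cod C (g \<cdot> f) = Cod C g"
  using Comp_hom[of f "Dom C f" "Cod C f" g "Cod C g"] assms by (auto simp: hom_def)

lemma Comp_Ide_right [simp]: "\<lbrakk>f \<in> Arr C; Dom C f = a\<rbrakk> \<Longrightarrow> f \<cdot> Ide C a = f"
  using Comp_Ide[of f a "Cod C f"] by (auto simp: hom_def)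

lemma Comp_Ide_left [simp]: "\<lbrakk>f \<in> Arr C; Cod C f = a\<rbrakk> \<Longrightarrow> Ide C a \<cdot> f = f"
  using Ide_Comp[of f "Dom C f" a] by (auto simp: hom_def)

lemma Comp_assoc_Arr:
  "\<lbrakk>f \<in> Arr C; g \<in> Arr C; k \<in> Arr C; Dom C g = Cod C f; Dom C k = Cod C g\<rbrakk>
    \<Longrightarrow> (k \<cdot> g) \<cdot> f = k \<cdot> (g \<cdot> f)"
  using Comp_assoc[of f "Dom C f" "Cod C f" g "Cod C g" k "Cod C k"] by (auto simp: hom_def)

lemma inverse_arrows_iff:
  "inverse_arrows C f g \<longleftrightarrow>
     f \<in> Arr C \<and> g \<in> Arr C \<and> Dom C g = Cod C f \<and> Cod C g = Dom C f \<and>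
     g \<cdot> f = Ide C (Dom C f) \<and> f \<cdot> g = Ide C (Cod C f)"
  by (auto simp: inverse_arrows_def hom_def)

lemma inv_arr_eqI:
  assumes g: "inverse_arrows C f g"
  shows "inv_arr C f = g"
  unfolding inv_arr_def
proof (rule the_equality)
  fix k assume k: "inverse_arrows C f k"
  have "k = k \<cdot> (f \<cdot> g)"
    using g k by (auto simp: inverse_arrows_iff)
  also have "\<dots> = (k \<cdot> f) \<cdot> g"
    using g k by (subst Comp_assoc_Arr) (auto simp: inverse_arrows_iff)
  also have "\<dots> = g"
    using g k by (auto simp: inverse_arrows_iff)
  finally show "k = g" .
qed (fact g)

lemma inverse_arrows_inv_arr:
  "invertible_arrow C f \<Longrightarrow> inverse_arrows C f (inv_arr C f)"
  unfolding invertible_arrow_def using inv_arr_eqI by metis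

lemma invertible_Arr: "invertible_arrow C f \<Longrightarrow> f \<in> Arr C"
  by (auto simp: invertible_arrow_def inverse_arrows_def)

lemma inv_arr [simp]:
  assumes "invertible_arrow C f"
  shows "inv_arr C f \<in> Arr C"
    and "Dom C (inv_arr C f) = Cod C f" and "Cod C (inv_arr C f) = Dom C f"
    and "inv_arr C f \<cdot> f = Ide C (Dom C f)" and "f \<cdot> inv_arr C f = Ide C (Cod C f)"
  using inverse_arrows_inv_arr[OF assms] by (auto simp: inverse_arrows_iff)

lemma inverse_arrows_Comp:
  assumes "inverse_arrows C f f'" "inverse_arrows C g g'" "Dom C g = Cod C f"
  shows "inverse_arrows C (g \<cdot> f) (f' \<cdot> g')"
proof -
  have "g' \<cdot> g \<cdot> f = f" "f \<cdot> f' \<cdot> g' = g'"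
    using assms by (simp_all add: inverse_arrows_iff Comp_assoc_Arr[symmetric])
  then show ?thesis
    using assms by (simp add: inverse_arrows_iff Comp_assoc_Arr)
qed

lemma isos_iff:
  "f \<in> isos C a b \<longleftrightarrow> invertible_arrow C f \<and> Dom C f = a \<and> Cod C f = b"
  using invertible_Arr by (auto simp: isos_def invertible_arrow_def hom_def)

lemma invertible_inv_arr [simp]: "invertible_arrow C f \<Longrightarrow> invertible_arrow C (inv_arr C f)"
  using inverse_arrows_inv_arr[of f] unfolding invertible_arrow_def
  by (auto simp: inverse_arrows_iff)

lemma invertible_Comp [simp]:
  "\<lbrakk>invertible_arrow C f; invertible_arrow C g; Dom C g = Cod C f\<rbrakk>
    \<Longrightarrow> invertible_arrow C (g \<cdot> f)"
  unfolding invertible_arrow_def using inverse_arrows_Comp by blast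

lemma invertible_cancel_right:
  assumes "f \<cdot> k = g \<cdot> k" "invertible_arrow C k" "f \<in> Arr C" "g \<in> Arr C"
    and "Dom C f = Cod C k" "Dom C g = Cod C k"
  shows "f = g"
proof -
  have "f \<cdot> k \<cdot> inv_arr C k = g \<cdot> k \<cdot> inv_arr C k"
    using assms invertible_Arr[OF assms(2)] by (metis Comp_assoc_Arr inv_arr(1,3))
  then show ?thesis
    using assms invertible_Arr[OF assms(2)] by simp
qed

end

section \<open>Monoidal categories and Kelly's unit lemma\<close>

context monoidal_category
begin

lemma TensO_Obj [simp]: "\<lbrakk>a \<in> Obj M; b \<in> Obj M\<rbrakk> \<Longrightarrow> a \<otimes>\<^sub>0 b \<in> Obj M"
  using cat_functor.OMap_closed[OF tensor_functor, of "(a, b)"] by (simp add: prod_cat_def)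

lemma UnitO_Obj [simp]: "\<one> \<in> Obj M"
  by (rule UnitO_closed)

lemma TensA_Arr [simp]:
  assumes "f \<in> Arr M" "g \<in> Arr M"
  shows "f \<otimes>\<^sub>1 g \<in> Arr M"
    and "Dom M (f \<otimes>\<^sub>1 g) = Dom M f \<otimes>\<^sub>0 Dom M g" and "Cod M (f \<otimes>\<^sub>1 g) = Cod M f \<otimes>\<^sub>0 Cod M g"
  using cat_functor.AMap_hom[OF tensor_functor, of "(f, g)" "(Dom M f, Dom M g)" "(Cod M f, Cod M g)"]
    assms by (auto simp: prod_cat_def hom_def)

lemma TensA_Ide [simp]:
  "\<lbrakk>a \<in> Obj M; b \<in> Obj M\<rbrakk> \<Longrightarrow> Ide M a \<otimes>\<^sub>1 Ide M b = Ide M (a \<otimes>\<^sub>0 b)"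
  using cat_functor.AMap_Ide[OF tensor_functor, of "(a, b)"] by (simp add: prod_cat_def)

lemma TensA_Comp:
  assumes "f \<in> Arr M" "g \<in> Arr M" "f' \<in> Arr M" "g' \<in> Arr M"
    and "Dom M g = Cod M f" "Dom M g' = Cod M f'"
  shows "(g \<otimes>\<^sub>1 g') \<cdot> (f \<otimes>\<^sub>1 f') = (g \<cdot> f) \<otimes>\<^sub>1 (g' \<cdot> f')"
  using cat_functor.AMap_Comp[OF tensor_functor, of "(f, f')" "(Dom M f, Dom M f')"
      "(Cod M f, Cod M f')" "(g, g')" "(Cod M g, Cod M g')"] assms
  by (simp add: prod_cat_def hom_def)

lemma inverse_arrows_TensA:
  "\<lbrakk>inverse_arrows M f f'; inverse_arrows M g g'\<rbrakk> \<Longrightarrow> inverse_arrows M (f \<otimes>\<^sub>1 g) (f' \<otimes>\<^sub>1 g')"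
  by (auto simp: inverse_arrows_iff TensA_Comp)

lemma invertible_Ide [simp]: "a \<in> Obj M \<Longrightarrow> invertible_arrow M (Ide M a)"
  unfolding invertible_arrow_def by (rule exI[of _ "Ide M a"]) (simp add: inverse_arrows_iff)

lemma invertible_TensA [simp]:
  "\<lbrakk>invertible_arrow M f; invertible_arrow M g\<rbrakk> \<Longrightarrow> invertible_arrow M (f \<otimes>\<^sub>1 g)"
  unfolding invertible_arrow_def using inverse_arrows_TensA by blast

lemma inv_arr_TensA:
  "\<lbrakk>invertible_arrow M f; invertible_arrow M g\<rbrakk>
    \<Longrightarrow> inv_arr M (f \<otimes>\<^sub>1 g) = inv_arr M f \<otimes>\<^sub>1 inv_arr M g"
  by (intro inv_arr_eqI inverse_arrows_TensA inverse_arrows_inv_arr)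

lemma LUnit_invertible [simp]:
  assumes "a \<in> Obj M"
  shows "invertible_arrow M (LUnit M a)"
    and "Dom M (LUnit M a) = \<one> \<otimes>\<^sub>0 a" and "Cod M (LUnit M a) = a"
  using natural_iso.component_iso[OF LUnit_natural, OF assms] by (auto simp: isos_iff)

lemma RUnit_invertible [simp]:
  assumes "a \<in> Obj M"
  shows "invertible_arrow M (RUnit M a)"
    and "Dom M (RUnit M a) = a \<otimes>\<^sub>0 \<one>" and "Cod M (RUnit M a) = a"
  using natural_iso.component_iso[OF RUnit_natural, OF assms] by (auto simp: isos_iff)

lemma Assoc_invertible [simp]:
  assumes "a \<in> Obj M" "b \<in> Obj M" "c \<in> Obj M"
  shows "invertible_arrow M (Assoc M a b c)"
    and "Dom M (Assoc M a b c) = (a \<otimes>\<^sub>0 b) \<otimes>\<^sub>0 c"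
    and "Cod M (Assoc M a b c) = a \<otimes>\<^sub>0 (b \<otimes>\<^sub>0 c)"
  using natural_iso.component_iso[OF Assoc_natural, of "(a, b, c)"] assms
  by (auto simp: isos_iff prod_cat_def)

lemma constraint_Arr [simp]:
  "a \<in> Obj M \<Longrightarrow> LUnit M a \<in> Arr M" "a \<in> Obj M \<Longrightarrow> RUnit M a \<in> Arr M"
  "\<lbrakk>a \<in> Obj M; b \<in> Obj M; c \<in> Obj M\<rbrakk> \<Longrightarrow> Assoc M a b c \<in> Arr M"
  using invertible_Arr by simp_all

lemma LUnit_naturality:
  "f \<in> Arr M \<Longrightarrow> LUnit M (Cod M f) \<cdot> (Ide M \<one> \<otimes>\<^sub>1 f) = f \<cdot> LUnit M (Dom M f)"
  using natural_iso.naturality[OF LUnit_natural, of f "Dom M f" "Cod M f"] by (simp add: hom_def)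

lemma RUnit_naturality:
  "f \<in> Arr M \<Longrightarrow> RUnit M (Cod M f) \<cdot> (f \<otimes>\<^sub>1 Ide M \<one>) = f \<cdot> RUnit M (Dom M f)"
  using natural_iso.naturality[OF RUnit_natural, of f "Dom M f" "Cod M f"] by (simp add: hom_def)

lemma Assoc_naturality:
  assumes "f \<in> Arr M" "g \<in> Arr M" "k \<in> Arr M"
  shows "Assoc M (Cod M f) (Cod M g) (Cod M k) \<cdot> ((f \<otimes>\<^sub>1 g) \<otimes>\<^sub>1 k)
         = (f \<otimes>\<^sub>1 (g \<otimes>\<^sub>1 k)) \<cdot> Assoc M (Dom M f) (Dom M g) (Dom M k)"
  using natural_iso.naturality[OF Assoc_natural, of "(f, g, k)" "(Dom M f, Dom M g, Dom M k)"
      "(Cod M f, Cod M g, Cod M k)"] assms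
  by (simp add: prod_cat_def hom_def)

text \<open>Naturality of the left unitor makes \<open>\<one> \<otimes> -\<close> conjugate to the identity, so it is faithful.\<close>

lemma unit_tensor_faithful:
  assumes "Ide M \<one> \<otimes>\<^sub>1 f = Ide M \<one> \<otimes>\<^sub>1 g"
    and "f \<in> Arr M" "g \<in> Arr M" "Dom M g = Dom M f" "Cod M g = Cod M f"
  shows "f = g"
proof (rule invertible_cancel_right)
  show "f \<cdot> LUnit M (Dom M f) = g \<cdot> LUnit M (Dom M f)"
    using LUnit_naturality[of f] LUnit_naturality[of g] assms by simp
qed (use assms in simp_all)

text \<open>
  Kelly's argument: after tensoring with \<open>\<one>\<close> on the left and precomposing with the two invertible
  associators of the pentagon, both sides reduce by the triangle axiom to the same arrow.
\<close>

lemma LUnit_tensor: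
  assumes [simp]: "b \<in> Obj M" "c \<in> Obj M"
  shows "LUnit M (b \<otimes>\<^sub>0 c) \<cdot> Assoc M \<one> b c = LUnit M b \<otimes>\<^sub>1 Ide M c"
proof (rule unit_tensor_faithful)
  let ?I = "Ide M \<one>" and ?A = "Assoc M" and ?k = "Assoc M \<one> \<one> b \<otimes>\<^sub>1 Ide M c"
  let ?f = "LUnit M (b \<otimes>\<^sub>0 c) \<cdot> ?A \<one> b c" and ?g = "LUnit M b \<otimes>\<^sub>1 Ide M c"
  have "((?I \<otimes>\<^sub>1 ?f) \<cdot> ?A \<one> (\<one> \<otimes>\<^sub>0 b) c) \<cdot> ?k
      = (?I \<otimes>\<^sub>1 LUnit M (b \<otimes>\<^sub>0 c)) \<cdot> (?I \<otimes>\<^sub>1 ?A \<one> b c) \<cdot> ?A \<one> (\<one> \<otimes>\<^sub>0 b) c \<cdot> ?k"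
    using TensA_Comp[of ?I ?I "?A \<one> b c" "LUnit M (b \<otimes>\<^sub>0 c)"]
    by (simp add: Comp_assoc_Arr[symmetric])
  also have "\<dots> = (?I \<otimes>\<^sub>1 LUnit M (b \<otimes>\<^sub>0 c)) \<cdot> ?A \<one> \<one> (b \<otimes>\<^sub>0 c) \<cdot> ?A (\<one> \<otimes>\<^sub>0 \<one>) b c"
    by (simp add: pentagon)
  also have "\<dots> = (RUnit M \<one> \<otimes>\<^sub>1 Ide M (b \<otimes>\<^sub>0 c)) \<cdot> ?A (\<one> \<otimes>\<^sub>0 \<one>) b c"
    using triangle[of \<one> "b \<otimes>\<^sub>0 c"] by (simp add: Comp_assoc_Arr[symmetric])
  also have "\<dots> = ?A \<one> b c \<cdot> ((RUnit M \<one> \<otimes>\<^sub>1 Ide M b) \<otimes>\<^sub>1 Ide M c)"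
    using Assoc_naturality[of "RUnit M \<one>" "Ide M b" "Ide M c"] by simp
  also have "\<dots> = ?A \<one> b c \<cdot> (((?I \<otimes>\<^sub>1 LUnit M b) \<otimes>\<^sub>1 Ide M c) \<cdot> ?k)"
    using triangle[of \<one> b] TensA_Comp[of "?A \<one> \<one> b" "?I \<otimes>\<^sub>1 LUnit M b" "Ide M c" "Ide M c"]
    by simp
  also have "\<dots> = ((?I \<otimes>\<^sub>1 ?g) \<cdot> ?A \<one> (\<one> \<otimes>\<^sub>0 b) c) \<cdot> ?k"
    using Assoc_naturality[of ?I "LUnit M b" "Ide M c"] by (simp add: Comp_assoc_Arr[symmetric])
  finally have "(?I \<otimes>\<^sub>1 ?f) \<cdot> ?A \<one> (\<one> \<otimes>\<^sub>0 b) c = (?I \<otimes>\<^sub>1 ?g) \<cdot> ?A \<one> (\<one> \<otimes>\<^sub>0 b) c"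
    by (rule invertible_cancel_right) simp_all
  then show "?I \<otimes>\<^sub>1 ?f = ?I \<otimes>\<^sub>1 ?g"
    by (rule invertible_cancel_right) simp_all
qed simp_all

end

section \<open>Interchange, and the passage between the two tensors\<close>

lemma horizontal_simps:
  "Obj (horizontal X) = Obj X" "Arr (horizontal X) = Arr X" "Dom (horizontal X) = Dom X"
  "Cod (horizontal X) = Cod X" "Ide (horizontal X) = Ide X" "Comp (horizontal X) = Comp X"
  "TensO (horizontal X) = HorO X" "TensA (horizontal X) = HorA X"
  "UnitO (horizontal X) = UnitO X"
  "Assoc (horizontal X) = (\<lambda>a b c. Ide X (HorO X a (HorO X b c)))"
  "LUnit (horizontal X) = Ide X" "RUnit (horizontal X) = Ide X"
  by (simp_all add: horizontal_def)

lemma horizontal_invertible: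
  "inverse_arrows (horizontal X) = inverse_arrows X"
  "invertible_arrow (horizontal X) = invertible_arrow X"
  "inv_arr (horizontal X) = inv_arr X" "hom (horizontal X) = hom X"
  by (auto simp: inverse_arrows_def invertible_arrow_def inv_arr_def hom_def horizontal_simps fun_eq_iff)

text \<open>
  The inverse of \<open>alpha\<close>, written without inverting anything: equations between composites of
  unitors and associators are easier to prove in this direction.
\<close>

definition alpha_inv :: "('o, 'm, 'z) ddcat_scheme \<Rightarrow> 'o \<Rightarrow> 'o \<Rightarrow> 'm" where
  "alpha_inv X a b = RUnit X a \<parallel>\<^sub>1\<^bsub>X\<^esub> LUnit X b"

text \<open>
  The first factor of the composite is the inverse of \<open>alpha_bar X b a\<close>, so this is the
  braiding transported along \<open>alpha\<close> to the horizontal tensor.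
\<close>

definition hor_swap :: "('o, 'm, 'z) ddcat_scheme \<Rightarrow> 'o \<Rightarrow> 'o \<Rightarrow> 'm" where
  "hor_swap X a b = (LUnit X b \<parallel>\<^sub>1\<^bsub>X\<^esub> RUnit X a) \<cdot>\<^bsub>X\<^esub> alpha X a b"

context dd_Bicats_category
begin

interpretation hor: strict_monoidal_category "horizontal X"
  by (rule horizontal_strict)

lemmas HorO_Obj [simp] = hor.TensO_Obj[unfolded horizontal_simps]
lemmas HorA_Arr [simp] = hor.TensA_Arr[unfolded horizontal_simps]
lemmas HorA_Ide [simp] = hor.TensA_Ide[unfolded horizontal_simps]
lemmas HorA_Comp = hor.TensA_Comp[unfolded horizontal_simps]
lemmas inverse_arrows_HorA = hor.inverse_arrows_TensA[unfolded horizontal_simps horizontal_invertible]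
lemmas invertible_HorA [simp] = hor.invertible_TensA[unfolded horizontal_simps horizontal_invertible]
lemmas inv_arr_HorA = hor.inv_arr_TensA[unfolded horizontal_simps horizontal_invertible]
lemmas HorO_unit [simp] = hor.strict_lunit[unfolded horizontal_simps] hor.strict_runit[unfolded horizontal_simps]
lemmas HorO_assoc [simp] = hor.strict_assoc[unfolded horizontal_simps]

text \<open>
  For a strict monoidal structure the laws on arrows are naturality of the constraints,
  all of which are identities.
\<close>

lemma HorA_unit [simp]:
  assumes "f \<in> Arr X"
  shows "Ide X \<one> \<parallel>\<^sub>1 f = f" and "f \<parallel>\<^sub>1 Ide X \<one> = f"
  using hor.LUnit_naturality[of f] hor.RUnit_naturality[of f] assms
  by (simp_all add: horizontal_simps)

lemma HorA_assoc [simp]: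
  assumes "f \<in> Arr X" "g \<in> Arr X" "k \<in> Arr X"
  shows "(f \<parallel>\<^sub>1 g) \<parallel>\<^sub>1 k = f \<parallel>\<^sub>1 (g \<parallel>\<^sub>1 k)"
  using hor.Assoc_naturality[of f g k] assms
  by (simp add: horizontal_simps)

lemma interchange_Obj:
  "\<lbrakk>a \<in> Obj X; b \<in> Obj X; c \<in> Obj X; d \<in> Obj X\<rbrakk>
    \<Longrightarrow> (a \<parallel>\<^sub>0 b) \<otimes>\<^sub>0 (c \<parallel>\<^sub>0 d) = (a \<otimes>\<^sub>0 c) \<parallel>\<^sub>0 (b \<otimes>\<^sub>0 d)"
  using strict_monoidal_functor.OMap_tensor[OF hor_tensor_strict, of "(a, b)" "(c, d)"]
  by (simp add: prod_moncat_def prod_cat_def cat.defs moncat.defs)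

lemma interchange_Arr:
  "\<lbrakk>f \<in> Arr X; g \<in> Arr X; f' \<in> Arr X; g' \<in> Arr X\<rbrakk>
    \<Longrightarrow> (f \<parallel>\<^sub>1 g) \<otimes>\<^sub>1 (f' \<parallel>\<^sub>1 g') = (f \<otimes>\<^sub>1 f') \<parallel>\<^sub>1 (g \<otimes>\<^sub>1 g')"
  using strict_monoidal_functor.AMap_tensor[OF hor_tensor_strict, of "(f, g)" "(f', g')"]
  by (simp add: prod_moncat_def prod_cat_def cat.defs moncat.defs)

lemma Assoc_HorO:
  "\<lbrakk>a \<in> Obj X; b \<in> Obj X; c \<in> Obj X; a' \<in> Obj X; b' \<in> Obj X; c' \<in> Obj X\<rbrakk>
    \<Longrightarrow> Assoc X (a \<parallel>\<^sub>0 a') (b \<parallel>\<^sub>0 b') (c \<parallel>\<^sub>0 c') = Assoc X a b c \<parallel>\<^sub>1 Assoc X a' b' c'"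
  using strict_monoidal_functor.AMap_Assoc[OF hor_tensor_strict, of "(a, a')" "(b, b')" "(c, c')"]
  by (simp add: prod_moncat_def prod_cat_def cat.defs moncat.defs)

lemma LUnit_HorO:
  "\<lbrakk>a \<in> Obj X; b \<in> Obj X\<rbrakk> \<Longrightarrow> LUnit X (a \<parallel>\<^sub>0 b) = LUnit X a \<parallel>\<^sub>1 LUnit X b"
  using strict_monoidal_functor.AMap_LUnit[OF hor_tensor_strict, of "(a, b)"]
  by (simp add: prod_moncat_def prod_cat_def cat.defs moncat.defs)

lemma RUnit_HorO:
  "\<lbrakk>a \<in> Obj X; b \<in> Obj X\<rbrakk> \<Longrightarrow> RUnit X (a \<parallel>\<^sub>0 b) = RUnit X a \<parallel>\<^sub>1 RUnit X b"
  using strict_monoidal_functor.AMap_RUnit[OF hor_tensor_strict, of "(a, b)"]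
  by (simp add: prod_moncat_def prod_cat_def cat.defs moncat.defs)

lemma unit_strict [simp]:
  "\<one> \<otimes>\<^sub>0 \<one> = \<one>" "LUnit X \<one> = Ide X \<one>" "RUnit X \<one> = Ide X \<one>"
  using strict_monoidal_functor.OMap_tensor[OF hor_unit_strict]
    strict_monoidal_functor.AMap_LUnit[OF hor_unit_strict]
    strict_monoidal_functor.AMap_RUnit[OF hor_unit_strict]
  by (simp_all add: terminal_moncat_def)

text \<open>The Eckmann--Hilton identities that give \<open>alpha\<close> and \<open>alpha_bar\<close> their codomains.\<close>

lemma tensor_as_HorO [simp]:
  assumes "a \<in> Obj X" "b \<in> Obj X"
  shows "(a \<otimes>\<^sub>0 \<one>) \<parallel>\<^sub>0 (\<one> \<otimes>\<^sub>0 b) = a \<otimes>\<^sub>0 b" and "(\<one> \<otimes>\<^sub>0 a) \<parallel>\<^sub>0 (b \<otimes>\<^sub>0 \<one>) = b \<otimes>\<^sub>0 a"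
  using interchange_Obj[of a \<one> \<one> b] interchange_Obj[of \<one> b a \<one>] assms by simp_all

lemma inverse_arrows_alpha_inv:
  assumes "a \<in> Obj X" "b \<in> Obj X"
  shows "inverse_arrows X (alpha_inv X a b) (alpha X a b)"
  unfolding alpha_inv_def alpha_def
  using assms by (intro inverse_arrows_HorA inverse_arrows_inv_arr) simp_all

lemma alpha_inv_Arr [simp]:
  assumes "a \<in> Obj X" "b \<in> Obj X"
  shows "alpha_inv X a b \<in> Arr X" "Dom X (alpha_inv X a b) = a \<otimes>\<^sub>0 b" "Cod X (alpha_inv X a b) = a \<parallel>\<^sub>0 b"
  using assms by (simp_all add: alpha_inv_def)

lemma alpha_Arr [simp]:
  assumes "a \<in> Obj X" "b \<in> Obj X"
  shows "alpha X a b \<in> Arr X" "Dom X (alpha X a b) = a \<parallel>\<^sub>0 b" "Cod X (alpha X a b) = a \<otimes>\<^sub>0 b"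
  using assms inverse_arrows_alpha_inv[OF assms] by (simp_all add: inverse_arrows_iff)

lemma alpha_inv_alpha [simp]:
  assumes "a \<in> Obj X" "b \<in> Obj X"
  shows "alpha_inv X a b \<cdot> alpha X a b = Ide X (a \<parallel>\<^sub>0 b)" "alpha X a b \<cdot> alpha_inv X a b = Ide X (a \<otimes>\<^sub>0 b)"
  using assms inverse_arrows_alpha_inv[OF assms] by (simp_all add: inverse_arrows_iff)

lemma inverse_arrows_alpha:
  assumes "a \<in> Obj X" "b \<in> Obj X"
  shows "inverse_arrows X (alpha X a b) (alpha_inv X a b)"
  using assms by (simp add: inverse_arrows_iff)

lemma invertible_alpha [simp]:
  assumes "a \<in> Obj X" "b \<in> Obj X"
  shows "invertible_arrow X (alpha X a b)" "invertible_arrow X (alpha_inv X a b)"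
  using inverse_arrows_alpha[OF assms] inverse_arrows_alpha_inv[OF assms]
  by (auto simp: invertible_arrow_def)

lemma alpha_inv_natural:
  assumes [simp]: "f \<in> Arr X" "g \<in> Arr X"
  shows "alpha_inv X (Cod X f) (Cod X g) \<cdot> (f \<otimes>\<^sub>1 g) = (f \<parallel>\<^sub>1 g) \<cdot> alpha_inv X (Dom X f) (Dom X g)"
proof -
  have "f \<otimes>\<^sub>1 g = (f \<otimes>\<^sub>1 Ide X \<one>) \<parallel>\<^sub>1 (Ide X \<one> \<otimes>\<^sub>1 g)"
    using interchange_Arr[of f "Ide X \<one>" "Ide X \<one>" g] by simp
  then show ?thesis
    by (simp add: alpha_inv_def HorA_Comp RUnit_naturality LUnit_naturality)
qed

lemma alpha_natural:
  assumes [simp]: "f \<in> Arr X" "g \<in> Arr X"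
  shows "alpha X (Cod X f) (Cod X g) \<cdot> (f \<parallel>\<^sub>1 g) = (f \<otimes>\<^sub>1 g) \<cdot> alpha X (Dom X f) (Dom X g)"
    (is "?a' \<cdot> _ = _ \<cdot> ?a")
proof -
  have "?a' \<cdot> (f \<parallel>\<^sub>1 g) = ?a' \<cdot> ((f \<parallel>\<^sub>1 g) \<cdot> alpha_inv X (Dom X f) (Dom X g)) \<cdot> ?a"
    by (simp add: Comp_assoc_Arr)
  also have "\<dots> = ?a' \<cdot> (alpha_inv X (Cod X f) (Cod X g) \<cdot> (f \<otimes>\<^sub>1 g)) \<cdot> ?a"
    by (simp only: alpha_inv_natural assms)
  also have "\<dots> = (?a' \<cdot> alpha_inv X (Cod X f) (Cod X g)) \<cdot> (f \<otimes>\<^sub>1 g) \<cdot> ?a"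
    by (simp add: Comp_assoc_Arr del: alpha_inv_alpha)
  finally show ?thesis
    by simp
qed

text \<open>
  Both sides split as horizontal composites of an arrow over \<open>a\<close>, one over \<open>b\<close> and one over \<open>c\<close>.
  Over \<open>a\<close> and \<open>c\<close> the equation is a triangle with two units; over \<open>b\<close> the associator is
  \<open>Assoc X \<one> b \<one>\<close>, and Kelly's unit lemma is needed.
\<close>

lemma alpha_inv_hexagon:
  assumes [simp]: "a \<in> Obj X" "b \<in> Obj X" "c \<in> Obj X"
  shows "(Ide X a \<parallel>\<^sub>1 alpha_inv X b c) \<cdot> alpha_inv X a (b \<otimes>\<^sub>0 c) \<cdot> Assoc X a b c
       = (alpha_inv X a b \<parallel>\<^sub>1 Ide X c) \<cdot> alpha_inv X (a \<otimes>\<^sub>0 b) c"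
proof -
  let ?I = "Ide X \<one>"
  have left: "RUnit X a \<cdot> Assoc X a \<one> \<one> = RUnit X a \<cdot> RUnit X (a \<otimes>\<^sub>0 \<one>)"
    using triangle[of a \<one>] RUnit_naturality[of "RUnit X a"] by simp
  have middle: "RUnit X b \<cdot> LUnit X (b \<otimes>\<^sub>0 \<one>) \<cdot> Assoc X \<one> b \<one> = LUnit X b \<cdot> RUnit X (\<one> \<otimes>\<^sub>0 b)"
    using LUnit_tensor[of b \<one>] RUnit_naturality[of "LUnit X b"] by simp
  have "LUnit X c \<cdot> LUnit X (\<one> \<otimes>\<^sub>0 c) \<cdot> Assoc X \<one> \<one> c
      = LUnit X c \<cdot> (?I \<otimes>\<^sub>1 LUnit X c) \<cdot> Assoc X \<one> \<one> c"
    using LUnit_naturality[of "LUnit X c"] by (simp add: Comp_assoc_Arr[symmetric])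
  then have right: "LUnit X c \<cdot> LUnit X (\<one> \<otimes>\<^sub>0 c) \<cdot> Assoc X \<one> \<one> c = LUnit X c"
    using triangle[of \<one> c] by simp
  have A: "Assoc X a b c = Assoc X a \<one> \<one> \<parallel>\<^sub>1 Assoc X \<one> b \<one> \<parallel>\<^sub>1 Assoc X \<one> \<one> c"
    using Assoc_HorO[of a \<one> \<one> \<one> "b" c] Assoc_HorO[of \<one> b \<one> \<one> \<one> c] by simp
  have L: "LUnit X (b \<otimes>\<^sub>0 c) = LUnit X (b \<otimes>\<^sub>0 \<one>) \<parallel>\<^sub>1 LUnit X (\<one> \<otimes>\<^sub>0 c)"
    using LUnit_HorO[of "b \<otimes>\<^sub>0 \<one>" "\<one> \<otimes>\<^sub>0 c"] by simp
  have R: "RUnit X (a \<otimes>\<^sub>0 b) = RUnit X (a \<otimes>\<^sub>0 \<one>) \<parallel>\<^sub>1 RUnit X (\<one> \<otimes>\<^sub>0 b)"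
    using RUnit_HorO[of "a \<otimes>\<^sub>0 \<one>" "\<one> \<otimes>\<^sub>0 b"] by simp
  show ?thesis
    unfolding alpha_inv_def A L R
    by (simp add: HorA_Comp left middle right)
qed

lemma hor_swap_Arr [simp]:
  assumes "a \<in> Obj X" "b \<in> Obj X"
  shows "hor_swap X a b \<in> Arr X"
    "Dom X (hor_swap X a b) = a \<parallel>\<^sub>0 b" "Cod X (hor_swap X a b) = b \<parallel>\<^sub>0 a"
  using assms by (simp_all add: hor_swap_def)

lemma alpha_hor_swap:
  assumes [simp]: "a \<in> Obj X" "b \<in> Obj X"
  shows "alpha X b a \<cdot> hor_swap X a b = braiding X a b \<cdot> alpha X a b"
proof -
  have "inv_arr X (alpha_bar X b a) = LUnit X b \<parallel>\<^sub>1 RUnit X a"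
    unfolding alpha_bar_def
    by (intro inv_arr_eqI inverse_arrows_HorA) (simp_all add: inverse_arrows_iff)
  then show ?thesis
    by (simp add: braiding_def hor_swap_def Comp_assoc_Arr)
qed

lemma braiding_Arr [simp]:
  assumes [simp]: "a \<in> Obj X" "b \<in> Obj X"
  shows "braiding X a b \<in> Arr X"
    "Dom X (braiding X a b) = a \<otimes>\<^sub>0 b" "Cod X (braiding X a b) = b \<otimes>\<^sub>0 a"
  by (simp_all add: braiding_def alpha_bar_def inv_arr_HorA)

lemma hor_swap_eq:
  assumes [simp]: "a \<in> Obj X" "b \<in> Obj X"
  shows "hor_swap X a b = alpha_inv X b a \<cdot> braiding X a b \<cdot> alpha X a b"
  by (simp add: alpha_hor_swap[symmetric] Comp_assoc_Arr[symmetric])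

text \<open>
  The outer factors over \<open>a\<close> and \<open>d\<close> agree. In the middle the left-hand side has
  \<open>alpha X b c\<close>, which uses the right unitor of \<open>b\<close> and the left unitor of \<open>c\<close>; on the right the same
  unitors appear with \<open>c\<close> to the left of \<open>b\<close>, which is \<open>alpha_bar X c b\<close>.
\<close>

lemma alpha_HorO:
  assumes [simp]: "a \<in> Obj X" "b \<in> Obj X" "c \<in> Obj X" "d \<in> Obj X"
  shows "alpha X (a \<parallel>\<^sub>0 b) (c \<parallel>\<^sub>0 d)
       = (alpha X a c \<parallel>\<^sub>1 alpha X b d) \<cdot> (Ide X a \<parallel>\<^sub>1 hor_swap X b c \<parallel>\<^sub>1 Ide X d)"
proof -
  have "(inv_arr X (LUnit X c) \<parallel>\<^sub>1 inv_arr X (RUnit X b)) \<cdot> hor_swap X b c = alpha X b c"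
    by (simp add: hor_swap_def Comp_assoc_Arr[symmetric] HorA_Comp)
  moreover have "alpha X a c \<parallel>\<^sub>1 alpha X b d = inv_arr X (RUnit X a) \<parallel>\<^sub>1
      (inv_arr X (LUnit X c) \<parallel>\<^sub>1 inv_arr X (RUnit X b)) \<parallel>\<^sub>1 inv_arr X (LUnit X d)"
    by (simp add: alpha_def)
  ultimately have "(alpha X a c \<parallel>\<^sub>1 alpha X b d) \<cdot> (Ide X a \<parallel>\<^sub>1 hor_swap X b c \<parallel>\<^sub>1 Ide X d)
      = inv_arr X (RUnit X a) \<parallel>\<^sub>1 alpha X b c \<parallel>\<^sub>1 inv_arr X (LUnit X d)"
    by (simp add: HorA_Comp del: HorA_assoc)
  also have "\<dots> = alpha X (a \<parallel>\<^sub>0 b) (c \<parallel>\<^sub>0 d)"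
    by (simp add: alpha_def RUnit_HorO LUnit_HorO inv_arr_HorA)
  finally show ?thesis ..
qed

text \<open>
  The associativity axiom for the identity functor with constraint \<open>alpha\<close>, from the horizontal
  to the vertical structure. It is \<open>alpha_inv_hexagon\<close> with all the inverses taken to the other
  side.
\<close>

lemma alpha_hexagon:
  assumes [simp]: "a \<in> Obj X" "b \<in> Obj X" "c \<in> Obj X"
  shows "Assoc X a b c \<cdot> alpha X (a \<otimes>\<^sub>0 b) c \<cdot> (alpha X a b \<parallel>\<^sub>1 Ide X c)
       = alpha X a (b \<otimes>\<^sub>0 c) \<cdot> (Ide X a \<parallel>\<^sub>1 alpha X b c)"
    (is "?A \<cdot> ?p \<cdot> ?p' = ?q \<cdot> ?q'")
proof -
  let ?r = "alpha_inv X (a \<otimes>\<^sub>0 b) c" and ?r' = "alpha_inv X a b \<parallel>\<^sub>1 Ide X c"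
    and ?s = "alpha_inv X a (b \<otimes>\<^sub>0 c)" and ?s' = "Ide X a \<parallel>\<^sub>1 alpha_inv X b c"
  have p: "inverse_arrows X (?p \<cdot> ?p') (?r' \<cdot> ?r)"
    by (intro inverse_arrows_Comp inverse_arrows_HorA inverse_arrows_alpha)
       (simp_all add: inverse_arrows_iff)
  have q: "inverse_arrows X (?q \<cdot> ?q') (?s' \<cdot> ?s)"
    by (intro inverse_arrows_Comp inverse_arrows_HorA inverse_arrows_alpha)
       (simp_all add: inverse_arrows_iff)
  have "?A \<cdot> ?p \<cdot> ?p' = ((?q \<cdot> ?q') \<cdot> (?s' \<cdot> ?s)) \<cdot> ?A \<cdot> ?p \<cdot> ?p'"
    using q unfolding inverse_arrows_iff by simp
  also have "\<dots> = (?q \<cdot> ?q') \<cdot> (?s' \<cdot> ?s \<cdot> ?A) \<cdot> ?p \<cdot> ?p'"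
    by (simp add: Comp_assoc_Arr del: alpha_inv_alpha)
  also have "\<dots> = (?q \<cdot> ?q') \<cdot> ((?r' \<cdot> ?r) \<cdot> (?p \<cdot> ?p'))"
    by (simp only: alpha_inv_hexagon assms)
  also have "\<dots> = ?q \<cdot> ?q'"
    using p unfolding inverse_arrows_iff by simp
  finally show ?thesis .
qed

end

section \<open>Monoidal functors\<close>

context cat_functor
begin

lemma OMap_Obj [simp]: "a \<in> Obj C \<Longrightarrow> OMap F a \<in> Obj D"
  by (rule OMap_closed)

lemma AMap_Arr [simp]:
  assumes "f \<in> Arr C"
  shows "AMap F f \<in> Arr D" and "Dom D (AMap F f) = OMap F (Dom C f)"
    and "Cod D (AMap F f) = OMap F (Cod C f)"
  using AMap_hom[of f "Dom C f" "Cod C f"] assms by (auto simp: hom_def)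

lemma AMap_Comp_Arr:
  "\<lbrakk>f \<in> Arr C; g \<in> Arr C; Dom C g = Cod C f\<rbrakk>
    \<Longrightarrow> AMap F (g \<cdot>\<^bsub>C\<^esub> f) = AMap F g \<cdot>\<^bsub>D\<^esub> AMap F f"
  using AMap_Comp[of f "Dom C f" "Cod C f" g "Cod C g"] by (auto simp: hom_def)

lemma inverse_arrows_AMap:
  "inverse_arrows C f g \<Longrightarrow> inverse_arrows D (AMap F f) (AMap F g)"
  using dom.Dom_closed dom.Cod_closed
  by (auto simp: dom.inverse_arrows_iff cod.inverse_arrows_iff AMap_Comp_Arr[symmetric] AMap_Ide)

lemma invertible_AMap [simp]: "invertible_arrow C f \<Longrightarrow> invertible_arrow D (AMap F f)"
  unfolding invertible_arrow_def using inverse_arrows_AMap by blast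

end

context monoidal_functor
begin

lemma v_invertible [simp]:
  assumes "a \<in> Obj M" "b \<in> Obj M"
  shows "invertible_arrow N (v a b)"
    and "v a b \<in> Arr N"
    and "Dom N (v a b) = OMap F a \<otimes>\<^sub>0\<^bsub>N\<^esub> OMap F b"
    and "Cod N (v a b) = OMap F (a \<otimes>\<^sub>0\<^bsub>M\<^esub> b)"
  using natural_iso.component_iso[OF constraint_natural, of "(a, b)"] assms cod.invertible_Arr
  by (auto simp: cod.isos_iff prod_cat_def)

lemma v_natural:
  assumes "f \<in> Arr M" "g \<in> Arr M"
  shows "v (Cod M f) (Cod M g) \<cdot>\<^bsub>N\<^esub> (AMap F f \<otimes>\<^sub>1\<^bsub>N\<^esub> AMap F g)
       = AMap F (f \<otimes>\<^sub>1\<^bsub>M\<^esub> g) \<cdot>\<^bsub>N\<^esub> v (Dom M f) (Dom M g)"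
  using natural_iso.naturality[OF constraint_natural, of "(f, g)" "(Dom M f, Dom M g)"
      "(Cod M f, Cod M g)"] assms
  by (simp add: prod_cat_def hom_def)

lemma unit_constraint [simp]:
  "\<eta> \<in> Arr N" "Dom N \<eta> = \<one>\<^bsub>N\<^esub>" "Cod N \<eta> = OMap F \<one>\<^bsub>M\<^esub>"
  using unit_constraint_iso cod.invertible_Arr by (auto simp: cod.isos_iff)

end

section \<open>The horizontal constraint of a braided functor\<close>

locale braided_functor =
  dom: dd_Bicats_category X + cod: dd_Bicats_category Y + monoidal_functor X Y F v \<eta>
  for X :: "('o1, 'm1, 'y) ddcat_scheme" and Y :: "('o2, 'm2, 'z) ddcat_scheme"
    and F :: "('o1, 'm1, 'o2, 'm2) functor_data"
    and v :: "'o1 \<Rightarrow> 'o1 \<Rightarrow> 'm2" and \<eta> :: "'m2" +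
  assumes braid: "\<lbrakk>a \<in> Obj X; b \<in> Obj X\<rbrakk> \<Longrightarrow>
    AMap F (braiding X a b) \<cdot>\<^bsub>Y\<^esub> v a b = v b a \<cdot>\<^bsub>Y\<^esub> braiding Y (OMap F a) (OMap F b)"
begin

abbreviation (input) comp_Y  (infixr \<open>\<bullet>\<close> 55) where "g \<bullet> f \<equiv> g \<cdot>\<^bsub>Y\<^esub> f"
abbreviation (input) ver_Y  (infixr \<open>\<otimes>\<close> 70) where "f \<otimes> g \<equiv> f \<otimes>\<^sub>1\<^bsub>Y\<^esub> g"
abbreviation (input) hor_Y  (infixr \<open>\<parallel>\<close> 70) where "f \<parallel> g \<equiv> f \<parallel>\<^sub>1\<^bsub>Y\<^esub> g"
abbreviation (input) F\<^sub>0 where "F\<^sub>0 \<equiv> OMap F"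
abbreviation (input) F\<^sub>1 where "F\<^sub>1 \<equiv> AMap F"

definition h :: "'o1 \<Rightarrow> 'o1 \<Rightarrow> 'm2" where
  "h a b = inv_arr Y (F\<^sub>1 (alpha X a b)) \<bullet> v a b \<bullet> alpha Y (F\<^sub>0 a) (F\<^sub>0 b)"

lemma h_eq:
  assumes "a \<in> Obj X" "b \<in> Obj X"
  shows "h a b = F\<^sub>1 (alpha_inv X a b) \<bullet> v a b \<bullet> alpha Y (F\<^sub>0 a) (F\<^sub>0 b)"
  using cod.inv_arr_eqI[OF inverse_arrows_AMap[OF dom.inverse_arrows_alpha[OF assms]]]
  by (simp add: h_def)

lemma h_invertible [simp]:
  assumes [simp]: "a \<in> Obj X" "b \<in> Obj X"
  shows "invertible_arrow Y (h a b)"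
    and "h a b \<in> Arr Y"
    and "Dom Y (h a b) = F\<^sub>0 a \<parallel>\<^sub>0\<^bsub>Y\<^esub> F\<^sub>0 b"
    and "Cod Y (h a b) = F\<^sub>0 (a \<parallel>\<^sub>0\<^bsub>X\<^esub> b)"
  by (simp_all add: h_eq)

lemma alpha_h:
  assumes [simp]: "a \<in> Obj X" "b \<in> Obj X"
  shows "F\<^sub>1 (alpha X a b) \<bullet> h a b = v a b \<bullet> alpha Y (F\<^sub>0 a) (F\<^sub>0 b)"
proof -
  have "F\<^sub>1 (alpha X a b) \<bullet> h a b
      = (F\<^sub>1 (alpha X a b) \<bullet> F\<^sub>1 (alpha_inv X a b)) \<bullet> v a b \<bullet> alpha Y (F\<^sub>0 a) (F\<^sub>0 b)"
    by (simp add: h_eq cod.Comp_assoc_Arr)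
  then show ?thesis
    by (simp add: AMap_Comp_Arr[symmetric] AMap_Ide)
qed

lemma h_natural:
  assumes [simp]: "f \<in> Arr X" "g \<in> Arr X"
  shows "h (Cod X f) (Cod X g) \<bullet> (F\<^sub>1 f \<parallel> F\<^sub>1 g)
       = F\<^sub>1 (f \<parallel>\<^sub>1\<^bsub>X\<^esub> g) \<bullet> h (Dom X f) (Dom X g)"
proof -
  let ?a = "Dom X f" and ?b = "Dom X g" and ?a' = "Cod X f" and ?b' = "Cod X g"
  let ?d = "alpha_inv X ?a ?b" and ?d' = "alpha_inv X ?a' ?b'" and ?e = "alpha Y (F\<^sub>0 ?a) (F\<^sub>0 ?b)"
  have "h ?a' ?b' \<bullet> (F\<^sub>1 f \<parallel> F\<^sub>1 g)
      = F\<^sub>1 ?d' \<bullet> v ?a' ?b' \<bullet> alpha Y (F\<^sub>0 ?a') (F\<^sub>0 ?b') \<bullet> (F\<^sub>1 f \<parallel> F\<^sub>1 g)"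
    by (simp add: h_eq cod.Comp_assoc_Arr)
  also have "\<dots> = F\<^sub>1 ?d' \<bullet> (v ?a' ?b' \<bullet> (F\<^sub>1 f \<otimes> F\<^sub>1 g)) \<bullet> ?e"
    using cod.alpha_natural[of "F\<^sub>1 f" "F\<^sub>1 g"] by (simp add: cod.Comp_assoc_Arr)
  also have "\<dots> = F\<^sub>1 (?d' \<cdot>\<^bsub>X\<^esub> (f \<otimes>\<^sub>1\<^bsub>X\<^esub> g)) \<bullet> v ?a ?b \<bullet> ?e"
    by (simp add: v_natural AMap_Comp_Arr cod.Comp_assoc_Arr)
  also have "\<dots> = F\<^sub>1 (f \<parallel>\<^sub>1\<^bsub>X\<^esub> g) \<bullet> h ?a ?b"
    by (simp add: dom.alpha_inv_natural AMap_Comp_Arr h_eq cod.Comp_assoc_Arr)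
  finally show ?thesis .
qed

lemma h_lunit:
  assumes [simp]: "a \<in> Obj X"
  shows "h \<one>\<^bsub>X\<^esub> a \<bullet> (\<eta> \<parallel> Ide Y (F\<^sub>0 a)) = Ide Y (F\<^sub>0 a)"
proof -
  have "h \<one>\<^bsub>X\<^esub> a \<bullet> (\<eta> \<parallel> Ide Y (F\<^sub>0 a))
      = F\<^sub>1 (LUnit X a) \<bullet> v \<one>\<^bsub>X\<^esub> a \<bullet> alpha Y (F\<^sub>0 \<one>\<^bsub>X\<^esub>) (F\<^sub>0 a) \<bullet> (\<eta> \<parallel> Ide Y (F\<^sub>0 a))"
    by (simp add: h_eq cod.Comp_assoc_Arr alpha_inv_def)
  also have "\<dots> = (F\<^sub>1 (LUnit X a) \<bullet> v \<one>\<^bsub>X\<^esub> a \<bullet> (\<eta> \<otimes> Ide Y (F\<^sub>0 a))) \<bullet> alpha Y \<one>\<^bsub>Y\<^esub> (F\<^sub>0 a)"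
    using cod.alpha_natural[of \<eta> "Ide Y (F\<^sub>0 a)"] by (simp add: cod.Comp_assoc_Arr)
  also have "\<dots> = alpha_inv Y \<one>\<^bsub>Y\<^esub> (F\<^sub>0 a) \<bullet> alpha Y \<one>\<^bsub>Y\<^esub> (F\<^sub>0 a)"
    by (simp add: constraint_lunit alpha_inv_def)
  finally show ?thesis
    by simp
qed

lemma h_runit:
  assumes [simp]: "a \<in> Obj X"
  shows "h a \<one>\<^bsub>X\<^esub> \<bullet> (Ide Y (F\<^sub>0 a) \<parallel> \<eta>) = Ide Y (F\<^sub>0 a)"
proof -
  have "h a \<one>\<^bsub>X\<^esub> \<bullet> (Ide Y (F\<^sub>0 a) \<parallel> \<eta>)
      = F\<^sub>1 (RUnit X a) \<bullet> v a \<one>\<^bsub>X\<^esub> \<bullet> alpha Y (F\<^sub>0 a) (F\<^sub>0 \<one>\<^bsub>X\<^esub>) \<bullet> (Ide Y (F\<^sub>0 a) \<parallel> \<eta>)"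
    by (simp add: h_eq cod.Comp_assoc_Arr alpha_inv_def)
  also have "\<dots> = (F\<^sub>1 (RUnit X a) \<bullet> v a \<one>\<^bsub>X\<^esub> \<bullet> (Ide Y (F\<^sub>0 a) \<otimes> \<eta>)) \<bullet> alpha Y (F\<^sub>0 a) \<one>\<^bsub>Y\<^esub>"
    using cod.alpha_natural[of "Ide Y (F\<^sub>0 a)" \<eta>] by (simp add: cod.Comp_assoc_Arr)
  also have "\<dots> = alpha_inv Y (F\<^sub>0 a) \<one>\<^bsub>Y\<^esub> \<bullet> alpha Y (F\<^sub>0 a) \<one>\<^bsub>Y\<^esub>"
    by (simp add: constraint_runit alpha_inv_def)
  finally show ?thesis
    by simp
qed

text \<open>
  The two iterated constraints are brought to a common form: inverse \<open>alpha\<close>s under \<open>F\<close>, then the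
  iterated \<open>v\<close>, then \<open>alpha\<close>s of \<open>Y\<close>. Each of these three parts has a known comparison
  between its two bracketings: the hexagons in \<open>X\<close> and \<open>Y\<close>, and the associativity of \<open>v\<close>.
\<close>

lemma h_h_left:
  assumes [simp]: "a \<in> Obj X" "b \<in> Obj X" "c \<in> Obj X"
  shows "h (a \<parallel>\<^sub>0\<^bsub>X\<^esub> b) c \<bullet> (h a b \<parallel> Ide Y (F\<^sub>0 c))
    = F\<^sub>1 ((alpha_inv X a b \<parallel>\<^sub>1\<^bsub>X\<^esub> Ide X c) \<cdot>\<^bsub>X\<^esub> alpha_inv X (a \<otimes>\<^sub>0\<^bsub>X\<^esub> b) c)
      \<bullet> v (a \<otimes>\<^sub>0\<^bsub>X\<^esub> b) c \<bullet> (v a b \<otimes> Ide Y (F\<^sub>0 c))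
      \<bullet> alpha Y (F\<^sub>0 a \<otimes>\<^sub>0\<^bsub>Y\<^esub> F\<^sub>0 b) (F\<^sub>0 c) \<bullet> (alpha Y (F\<^sub>0 a) (F\<^sub>0 b) \<parallel> Ide Y (F\<^sub>0 c))"
proof -
  let ?c = "Ide Y (F\<^sub>0 c)"
  have "h a b \<parallel> ?c = (F\<^sub>1 (alpha_inv X a b) \<parallel> F\<^sub>1 (Ide X c)) \<bullet> (v a b \<parallel> ?c)
      \<bullet> (alpha Y (F\<^sub>0 a) (F\<^sub>0 b) \<parallel> ?c)"
    by (simp add: h_eq cod.HorA_Comp AMap_Ide)
  then have "h (a \<parallel>\<^sub>0\<^bsub>X\<^esub> b) c \<bullet> (h a b \<parallel> ?c)
      = (h (a \<parallel>\<^sub>0\<^bsub>X\<^esub> b) c \<bullet> (F\<^sub>1 (alpha_inv X a b) \<parallel> F\<^sub>1 (Ide X c))) \<bullet> (v a b \<parallel> ?c)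
      \<bullet> (alpha Y (F\<^sub>0 a) (F\<^sub>0 b) \<parallel> ?c)"
    by (simp add: cod.Comp_assoc_Arr)
  also have "\<dots> = F\<^sub>1 (alpha_inv X a b \<parallel>\<^sub>1\<^bsub>X\<^esub> Ide X c) \<bullet> h (a \<otimes>\<^sub>0\<^bsub>X\<^esub> b) c \<bullet> (v a b \<parallel> ?c)
      \<bullet> (alpha Y (F\<^sub>0 a) (F\<^sub>0 b) \<parallel> ?c)"
    using h_natural[of "alpha_inv X a b" "Ide X c"] by (simp add: cod.Comp_assoc_Arr)
  also have "\<dots> = F\<^sub>1 (alpha_inv X a b \<parallel>\<^sub>1\<^bsub>X\<^esub> Ide X c) \<bullet> F\<^sub>1 (alpha_inv X (a \<otimes>\<^sub>0\<^bsub>X\<^esub> b) c)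
      \<bullet> v (a \<otimes>\<^sub>0\<^bsub>X\<^esub> b) c \<bullet> (alpha Y (F\<^sub>0 (a \<otimes>\<^sub>0\<^bsub>X\<^esub> b)) (F\<^sub>0 c) \<bullet> (v a b \<parallel> ?c))
      \<bullet> (alpha Y (F\<^sub>0 a) (F\<^sub>0 b) \<parallel> ?c)"
    by (simp add: cod.Comp_assoc_Arr h_eq[of "a \<otimes>\<^sub>0\<^bsub>X\<^esub> b"])
  also have "alpha Y (F\<^sub>0 (a \<otimes>\<^sub>0\<^bsub>X\<^esub> b)) (F\<^sub>0 c) \<bullet> (v a b \<parallel> ?c)
      = (v a b \<otimes> ?c) \<bullet> alpha Y (F\<^sub>0 a \<otimes>\<^sub>0\<^bsub>Y\<^esub> F\<^sub>0 b) (F\<^sub>0 c)"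
    using cod.alpha_natural[of "v a b" ?c] by simp
  finally show ?thesis
    by (simp add: AMap_Comp_Arr cod.Comp_assoc_Arr)
qed

lemma h_h_right:
  assumes [simp]: "a \<in> Obj X" "b \<in> Obj X" "c \<in> Obj X"
  shows "h a (b \<parallel>\<^sub>0\<^bsub>X\<^esub> c) \<bullet> (Ide Y (F\<^sub>0 a) \<parallel> h b c)
    = F\<^sub>1 ((Ide X a \<parallel>\<^sub>1\<^bsub>X\<^esub> alpha_inv X b c) \<cdot>\<^bsub>X\<^esub> alpha_inv X a (b \<otimes>\<^sub>0\<^bsub>X\<^esub> c))
      \<bullet> v a (b \<otimes>\<^sub>0\<^bsub>X\<^esub> c) \<bullet> (Ide Y (F\<^sub>0 a) \<otimes> v b c)
      \<bullet> alpha Y (F\<^sub>0 a) (F\<^sub>0 b \<otimes>\<^sub>0\<^bsub>Y\<^esub> F\<^sub>0 c) \<bullet> (Ide Y (F\<^sub>0 a) \<parallel> alpha Y (F\<^sub>0 b) (F\<^sub>0 c))"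
proof -
  let ?a = "Ide Y (F\<^sub>0 a)"
  have "?a \<parallel> h b c = (F\<^sub>1 (Ide X a) \<parallel> F\<^sub>1 (alpha_inv X b c)) \<bullet> (?a \<parallel> v b c)
      \<bullet> (?a \<parallel> alpha Y (F\<^sub>0 b) (F\<^sub>0 c))"
    by (simp add: h_eq cod.HorA_Comp AMap_Ide)
  then have "h a (b \<parallel>\<^sub>0\<^bsub>X\<^esub> c) \<bullet> (?a \<parallel> h b c)
      = (h a (b \<parallel>\<^sub>0\<^bsub>X\<^esub> c) \<bullet> (F\<^sub>1 (Ide X a) \<parallel> F\<^sub>1 (alpha_inv X b c))) \<bullet> (?a \<parallel> v b c)
      \<bullet> (?a \<parallel> alpha Y (F\<^sub>0 b) (F\<^sub>0 c))"
    by (simp add: cod.Comp_assoc_Arr)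
  also have "\<dots> = F\<^sub>1 (Ide X a \<parallel>\<^sub>1\<^bsub>X\<^esub> alpha_inv X b c) \<bullet> h a (b \<otimes>\<^sub>0\<^bsub>X\<^esub> c) \<bullet> (?a \<parallel> v b c)
      \<bullet> (?a \<parallel> alpha Y (F\<^sub>0 b) (F\<^sub>0 c))"
    using h_natural[of "Ide X a" "alpha_inv X b c"] by (simp add: cod.Comp_assoc_Arr)
  also have "\<dots> = F\<^sub>1 (Ide X a \<parallel>\<^sub>1\<^bsub>X\<^esub> alpha_inv X b c) \<bullet> F\<^sub>1 (alpha_inv X a (b \<otimes>\<^sub>0\<^bsub>X\<^esub> c))
      \<bullet> v a (b \<otimes>\<^sub>0\<^bsub>X\<^esub> c) \<bullet> (alpha Y (F\<^sub>0 a) (F\<^sub>0 (b \<otimes>\<^sub>0\<^bsub>X\<^esub> c)) \<bullet> (?a \<parallel> v b c))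
      \<bullet> (?a \<parallel> alpha Y (F\<^sub>0 b) (F\<^sub>0 c))"
    by (simp add: cod.Comp_assoc_Arr h_eq[of a])
  also have "alpha Y (F\<^sub>0 a) (F\<^sub>0 (b \<otimes>\<^sub>0\<^bsub>X\<^esub> c)) \<bullet> (?a \<parallel> v b c)
      = (?a \<otimes> v b c) \<bullet> alpha Y (F\<^sub>0 a) (F\<^sub>0 b \<otimes>\<^sub>0\<^bsub>Y\<^esub> F\<^sub>0 c)"
    using cod.alpha_natural[of ?a "v b c"] by simp
  finally show ?thesis
    by (simp add: AMap_Comp_Arr cod.Comp_assoc_Arr)
qed

text \<open>
  The hexagon of \<open>X\<close> produces an associator under \<open>F\<close>, the associativity of \<open>v\<close> moves it to
  \<open>Y\<close>, and the hexagon of \<open>Y\<close> absorbs it.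
\<close>

lemma h_assoc:
  assumes [simp]: "a \<in> Obj X" "b \<in> Obj X" "c \<in> Obj X"
  shows "h (a \<parallel>\<^sub>0\<^bsub>X\<^esub> b) c \<bullet> (h a b \<parallel> Ide Y (F\<^sub>0 c)) = h a (b \<parallel>\<^sub>0\<^bsub>X\<^esub> c) \<bullet> (Ide Y (F\<^sub>0 a) \<parallel> h b c)"
proof -
  let ?d = "(Ide X a \<parallel>\<^sub>1\<^bsub>X\<^esub> alpha_inv X b c) \<cdot>\<^bsub>X\<^esub> alpha_inv X a (b \<otimes>\<^sub>0\<^bsub>X\<^esub> c)"
  let ?e = "alpha Y (F\<^sub>0 a \<otimes>\<^sub>0\<^bsub>Y\<^esub> F\<^sub>0 b) (F\<^sub>0 c) \<bullet> (alpha Y (F\<^sub>0 a) (F\<^sub>0 b) \<parallel> Ide Y (F\<^sub>0 c))"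
  have "h (a \<parallel>\<^sub>0\<^bsub>X\<^esub> b) c \<bullet> (h a b \<parallel> Ide Y (F\<^sub>0 c))
      = F\<^sub>1 (?d \<cdot>\<^bsub>X\<^esub> Assoc X a b c) \<bullet> v (a \<otimes>\<^sub>0\<^bsub>X\<^esub> b) c \<bullet> (v a b \<otimes> Ide Y (F\<^sub>0 c)) \<bullet> ?e"
    using dom.alpha_inv_hexagon[of a b c] by (simp add: h_h_left dom.Comp_assoc_Arr)
  also have "\<dots> = F\<^sub>1 ?d \<bullet> (F\<^sub>1 (Assoc X a b c) \<bullet> v (a \<otimes>\<^sub>0\<^bsub>X\<^esub> b) c \<bullet> (v a b \<otimes> Ide Y (F\<^sub>0 c))) \<bullet> ?e"
    by (simp add: AMap_Comp_Arr cod.Comp_assoc_Arr)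
  also have "\<dots> = F\<^sub>1 ?d \<bullet> v a (b \<otimes>\<^sub>0\<^bsub>X\<^esub> c) \<bullet> (Ide Y (F\<^sub>0 a) \<otimes> v b c)
      \<bullet> Assoc Y (F\<^sub>0 a) (F\<^sub>0 b) (F\<^sub>0 c) \<bullet> ?e"
    by (simp add: constraint_assoc cod.Comp_assoc_Arr)
  also have "\<dots> = h a (b \<parallel>\<^sub>0\<^bsub>X\<^esub> c) \<bullet> (Ide Y (F\<^sub>0 a) \<parallel> h b c)"
    by (simp add: cod.alpha_hexagon h_h_right)
  finally show ?thesis .
qed

text \<open>The braid axiom, transported along \<open>alpha\<close> to the horizontal tensors.\<close>

lemma h_hor_swap:
  assumes [simp]: "a \<in> Obj X" "b \<in> Obj X"
  shows "F\<^sub>1 (hor_swap X a b) \<bullet> h a b = h b a \<bullet> hor_swap Y (F\<^sub>0 a) (F\<^sub>0 b)"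
proof -
  have "F\<^sub>1 (hor_swap X a b) \<bullet> h a b
      = F\<^sub>1 (alpha_inv X b a) \<bullet> (F\<^sub>1 (braiding X a b) \<bullet> v a b) \<bullet> alpha Y (F\<^sub>0 a) (F\<^sub>0 b)"
    by (simp add: dom.hor_swap_eq AMap_Comp_Arr alpha_h cod.Comp_assoc_Arr)
  also have "\<dots> = F\<^sub>1 (alpha_inv X b a) \<bullet> v b a \<bullet> braiding Y (F\<^sub>0 a) (F\<^sub>0 b) \<bullet> alpha Y (F\<^sub>0 a) (F\<^sub>0 b)"
    by (simp add: braid cod.Comp_assoc_Arr)
  also have "\<dots> = h b a \<bullet> hor_swap Y (F\<^sub>0 a) (F\<^sub>0 b)"
    by (simp add: h_eq cod.alpha_hor_swap cod.Comp_assoc_Arr)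
  finally show ?thesis .
qed

text \<open>
  Associativity rebrackets the fourfold constraint so that the middle pair is
  combined first, where a swap of that pair can act.
\<close>

lemma h_four:
  assumes [simp]: "a \<in> Obj X" "b \<in> Obj X" "c \<in> Obj X" "d \<in> Obj X"
  shows "h (a \<parallel>\<^sub>0\<^bsub>X\<^esub> b) (c \<parallel>\<^sub>0\<^bsub>X\<^esub> d) \<bullet> (h a b \<parallel> h c d)
    = h a (b \<parallel>\<^sub>0\<^bsub>X\<^esub> c \<parallel>\<^sub>0\<^bsub>X\<^esub> d)
      \<bullet> (Ide Y (F\<^sub>0 a) \<parallel> (h (b \<parallel>\<^sub>0\<^bsub>X\<^esub> c) d \<bullet> (h b c \<parallel> Ide Y (F\<^sub>0 d))))"
proof -
  let ?a = "Ide Y (F\<^sub>0 a)" and ?b = "Ide Y (F\<^sub>0 b)" and ?cd = "Ide Y (F\<^sub>0 (c \<parallel>\<^sub>0\<^bsub>X\<^esub> d))"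
  have "h a b \<parallel> h c d = (h a b \<parallel> ?cd) \<bullet> ((?a \<parallel> ?b) \<parallel> h c d)"
    by (simp add: cod.HorA_Comp del: cod.HorA_assoc)
  then have "h (a \<parallel>\<^sub>0\<^bsub>X\<^esub> b) (c \<parallel>\<^sub>0\<^bsub>X\<^esub> d) \<bullet> (h a b \<parallel> h c d)
      = (h (a \<parallel>\<^sub>0\<^bsub>X\<^esub> b) (c \<parallel>\<^sub>0\<^bsub>X\<^esub> d) \<bullet> (h a b \<parallel> ?cd)) \<bullet> (?a \<parallel> ?b \<parallel> h c d)"
    by (simp add: cod.Comp_assoc_Arr del: cod.HorA_Ide)
  also have "\<dots> = h a (b \<parallel>\<^sub>0\<^bsub>X\<^esub> c \<parallel>\<^sub>0\<^bsub>X\<^esub> d) \<bullet> (?a \<parallel> h b (c \<parallel>\<^sub>0\<^bsub>X\<^esub> d)) \<bullet> (?a \<parallel> ?b \<parallel> h c d)"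
    by (simp add: h_assoc cod.Comp_assoc_Arr)
  also have "\<dots> = h a (b \<parallel>\<^sub>0\<^bsub>X\<^esub> c \<parallel>\<^sub>0\<^bsub>X\<^esub> d) \<bullet> (?a \<parallel> (h b (c \<parallel>\<^sub>0\<^bsub>X\<^esub> d) \<bullet> (?b \<parallel> h c d)))"
    by (simp add: cod.HorA_Comp)
  finally show ?thesis
    by (simp add: h_assoc)
qed

lemma h_middle_swap:
  assumes [simp]: "a \<in> Obj X" "b \<in> Obj X" "c \<in> Obj X" "d \<in> Obj X"
  shows "F\<^sub>1 (Ide X a \<parallel>\<^sub>1\<^bsub>X\<^esub> hor_swap X b c \<parallel>\<^sub>1\<^bsub>X\<^esub> Ide X d)
        \<bullet> h (a \<parallel>\<^sub>0\<^bsub>X\<^esub> b) (c \<parallel>\<^sub>0\<^bsub>X\<^esub> d) \<bullet> (h a b \<parallel> h c d)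
    = h (a \<parallel>\<^sub>0\<^bsub>X\<^esub> c) (b \<parallel>\<^sub>0\<^bsub>X\<^esub> d) \<bullet> (h a c \<parallel> h b d)
        \<bullet> (Ide Y (F\<^sub>0 a) \<parallel> hor_swap Y (F\<^sub>0 b) (F\<^sub>0 c) \<parallel> Ide Y (F\<^sub>0 d))"
proof -
  let ?a = "Ide Y (F\<^sub>0 a)" and ?d = "Ide Y (F\<^sub>0 d)"
  let ?s = "hor_swap X b c" and ?t = "hor_swap Y (F\<^sub>0 b) (F\<^sub>0 c)"
  let ?sd = "?s \<parallel>\<^sub>1\<^bsub>X\<^esub> Ide X d"
  have "F\<^sub>1 ?sd \<bullet> h (b \<parallel>\<^sub>0\<^bsub>X\<^esub> c) d \<bullet> (h b c \<parallel> ?d)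
      = h (c \<parallel>\<^sub>0\<^bsub>X\<^esub> b) d \<bullet> (F\<^sub>1 ?s \<parallel> ?d) \<bullet> (h b c \<parallel> ?d)"
    using h_natural[of ?s "Ide X d"] by (simp add: AMap_Ide cod.Comp_assoc_Arr[symmetric])
  also have "\<dots> = h (c \<parallel>\<^sub>0\<^bsub>X\<^esub> b) d \<bullet> (h c b \<parallel> ?d) \<bullet> (?t \<parallel> ?d)"
    by (simp add: cod.HorA_Comp h_hor_swap)
  finally have inner: "F\<^sub>1 ?sd \<bullet> h (b \<parallel>\<^sub>0\<^bsub>X\<^esub> c) d \<bullet> (h b c \<parallel> ?d)
      = h (c \<parallel>\<^sub>0\<^bsub>X\<^esub> b) d \<bullet> (h c b \<parallel> ?d) \<bullet> (?t \<parallel> ?d)" .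
  have "F\<^sub>1 (Ide X a \<parallel>\<^sub>1\<^bsub>X\<^esub> ?sd) \<bullet> h (a \<parallel>\<^sub>0\<^bsub>X\<^esub> b) (c \<parallel>\<^sub>0\<^bsub>X\<^esub> d) \<bullet> (h a b \<parallel> h c d)
      = (F\<^sub>1 (Ide X a \<parallel>\<^sub>1\<^bsub>X\<^esub> ?sd) \<bullet> h a (b \<parallel>\<^sub>0\<^bsub>X\<^esub> c \<parallel>\<^sub>0\<^bsub>X\<^esub> d))
        \<bullet> (?a \<parallel> (h (b \<parallel>\<^sub>0\<^bsub>X\<^esub> c) d \<bullet> (h b c \<parallel> ?d)))"
    by (simp add: h_four cod.Comp_assoc_Arr)
  also have "\<dots> = h a (c \<parallel>\<^sub>0\<^bsub>X\<^esub> b \<parallel>\<^sub>0\<^bsub>X\<^esub> d) \<bullet> (?a \<parallel> F\<^sub>1 ?sd)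
        \<bullet> (?a \<parallel> (h (b \<parallel>\<^sub>0\<^bsub>X\<^esub> c) d \<bullet> (h b c \<parallel> ?d)))"
    using h_natural[of "Ide X a" ?sd] by (simp add: AMap_Ide cod.Comp_assoc_Arr[symmetric])
  also have "\<dots> = h a (c \<parallel>\<^sub>0\<^bsub>X\<^esub> b \<parallel>\<^sub>0\<^bsub>X\<^esub> d) \<bullet> (?a \<parallel> (h (c \<parallel>\<^sub>0\<^bsub>X\<^esub> b) d \<bullet> (h c b \<parallel> ?d) \<bullet> (?t \<parallel> ?d)))"
    by (simp add: cod.HorA_Comp inner)
  also have "\<dots> = (h a (c \<parallel>\<^sub>0\<^bsub>X\<^esub> b \<parallel>\<^sub>0\<^bsub>X\<^esub> d) \<bullet> (?a \<parallel> (h (c \<parallel>\<^sub>0\<^bsub>X\<^esub> b) d \<bullet> (h c b \<parallel> ?d))))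
        \<bullet> (?a \<parallel> ?t \<parallel> ?d)"
    by (simp add: cod.HorA_Comp cod.Comp_assoc_Arr)
  also have "\<dots> = h (a \<parallel>\<^sub>0\<^bsub>X\<^esub> c) (b \<parallel>\<^sub>0\<^bsub>X\<^esub> d) \<bullet> (h a c \<parallel> h b d) \<bullet> (?a \<parallel> ?t \<parallel> ?d)"
    by (simp add: h_four[symmetric] cod.Comp_assoc_Arr)
  finally show ?thesis .
qed

text \<open>
  Composing with an \<open>alpha\<close> on the right turns every \<open>v\<close> into an \<open>h\<close>. Decomposing the resulting
  \<open>alpha\<close> of horizontal composites in both \<open>X\<close> and \<open>Y\<close> leaves the compatibility of \<open>h\<close> with
  the middle swap.
\<close>

lemma v_h_interaction:
  assumes [simp]: "a \<in> Obj X" "b \<in> Obj X" "c \<in> Obj X" "d \<in> Obj X"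
  shows "v (a \<parallel>\<^sub>0\<^bsub>X\<^esub> b) (c \<parallel>\<^sub>0\<^bsub>X\<^esub> d) \<bullet> (h a b \<otimes> h c d)
       = h (a \<otimes>\<^sub>0\<^bsub>X\<^esub> c) (b \<otimes>\<^sub>0\<^bsub>X\<^esub> d) \<bullet> (v a c \<parallel> v b d)"
proof (rule cod.invertible_cancel_right)
  let ?al = "alpha Y (F\<^sub>0 a \<parallel>\<^sub>0\<^bsub>Y\<^esub> F\<^sub>0 b) (F\<^sub>0 c \<parallel>\<^sub>0\<^bsub>Y\<^esub> F\<^sub>0 d)"
  let ?t = "Ide Y (F\<^sub>0 a) \<parallel> hor_swap Y (F\<^sub>0 b) (F\<^sub>0 c) \<parallel> Ide Y (F\<^sub>0 d)"
    and ?s = "Ide X a \<parallel>\<^sub>1\<^bsub>X\<^esub> hor_swap X b c \<parallel>\<^sub>1\<^bsub>X\<^esub> Ide X d"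
  let ?aa = "alpha X a c \<parallel>\<^sub>1\<^bsub>X\<^esub> alpha X b d"
  have "(v (a \<parallel>\<^sub>0\<^bsub>X\<^esub> b) (c \<parallel>\<^sub>0\<^bsub>X\<^esub> d) \<bullet> (h a b \<otimes> h c d)) \<bullet> ?al
      = (v (a \<parallel>\<^sub>0\<^bsub>X\<^esub> b) (c \<parallel>\<^sub>0\<^bsub>X\<^esub> d) \<bullet> alpha Y (F\<^sub>0 (a \<parallel>\<^sub>0\<^bsub>X\<^esub> b)) (F\<^sub>0 (c \<parallel>\<^sub>0\<^bsub>X\<^esub> d))) \<bullet> (h a b \<parallel> h c d)"
    using cod.alpha_natural[of "h a b" "h c d"] by (simp add: cod.Comp_assoc_Arr)
  also have "\<dots> = F\<^sub>1 (alpha X (a \<parallel>\<^sub>0\<^bsub>X\<^esub> b) (c \<parallel>\<^sub>0\<^bsub>X\<^esub> d))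
      \<bullet> h (a \<parallel>\<^sub>0\<^bsub>X\<^esub> b) (c \<parallel>\<^sub>0\<^bsub>X\<^esub> d) \<bullet> (h a b \<parallel> h c d)"
    by (simp add: alpha_h[symmetric] cod.Comp_assoc_Arr)
  also have "\<dots> = F\<^sub>1 ?aa \<bullet> F\<^sub>1 ?s \<bullet> h (a \<parallel>\<^sub>0\<^bsub>X\<^esub> b) (c \<parallel>\<^sub>0\<^bsub>X\<^esub> d) \<bullet> (h a b \<parallel> h c d)"
    unfolding dom.alpha_HorO[OF assms]
    by (simp add: AMap_Comp_Arr cod.Comp_assoc_Arr del: dom.HorA_assoc)
  also have "\<dots> = (F\<^sub>1 ?aa \<bullet> h (a \<parallel>\<^sub>0\<^bsub>X\<^esub> c) (b \<parallel>\<^sub>0\<^bsub>X\<^esub> d)) \<bullet> (h a c \<parallel> h b d) \<bullet> ?t"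
    by (simp only: h_middle_swap assms) (simp add: cod.Comp_assoc_Arr)
  also have "\<dots> = h (a \<otimes>\<^sub>0\<^bsub>X\<^esub> c) (b \<otimes>\<^sub>0\<^bsub>X\<^esub> d)
      \<bullet> ((F\<^sub>1 (alpha X a c) \<parallel> F\<^sub>1 (alpha X b d)) \<bullet> (h a c \<parallel> h b d)) \<bullet> ?t"
    using h_natural[of "alpha X a c" "alpha X b d"] by (simp add: cod.Comp_assoc_Arr[symmetric])
  also have "\<dots> = h (a \<otimes>\<^sub>0\<^bsub>X\<^esub> c) (b \<otimes>\<^sub>0\<^bsub>X\<^esub> d)
      \<bullet> ((v a c \<parallel> v b d) \<bullet> (alpha Y (F\<^sub>0 a) (F\<^sub>0 c) \<parallel> alpha Y (F\<^sub>0 b) (F\<^sub>0 d))) \<bullet> ?t"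
    by (simp add: cod.HorA_Comp alpha_h)
  also have "\<dots> = (h (a \<otimes>\<^sub>0\<^bsub>X\<^esub> c) (b \<otimes>\<^sub>0\<^bsub>X\<^esub> d) \<bullet> (v a c \<parallel> v b d)) \<bullet> ?al"
    by (simp add: cod.alpha_HorO cod.Comp_assoc_Arr del: cod.HorA_assoc)
  finally show "(v (a \<parallel>\<^sub>0\<^bsub>X\<^esub> b) (c \<parallel>\<^sub>0\<^bsub>X\<^esub> d) \<bullet> (h a b \<otimes> h c d)) \<bullet> ?al
      = (h (a \<otimes>\<^sub>0\<^bsub>X\<^esub> c) (b \<otimes>\<^sub>0\<^bsub>X\<^esub> d) \<bullet> (v a c \<parallel> v b d)) \<bullet> ?al" .
qed (simp_all add: dom.interchange_Obj cod.interchange_Obj)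

lemma horizontal_monoidal_functor:
  "monoidal_functor (horizontal X) (horizontal Y) F h \<eta>"
proof -
  interpret X: strict_monoidal_category "horizontal X"
    by (rule dom.horizontal_strict)
  interpret Y: strict_monoidal_category "horizontal Y"
    by (rule cod.horizontal_strict)
  interpret XX: category "prod_cat (horizontal X) (horizontal X)"
    by (rule cat_functor.axioms(1)[OF X.tensor_functor])
  interpret HF: cat_functor "horizontal X" "horizontal Y" F
    by unfold_locales
       (auto simp: horizontal_simps horizontal_invertible hom_def AMap_Ide AMap_Comp_Arr)
  have "natural_iso (prod_cat (horizontal X) (horizontal X)) (horizontal Y)
     \<lparr>OMap = \<lambda>(a, b). F\<^sub>0 a \<parallel>\<^sub>0\<^bsub>Y\<^esub> F\<^sub>0 b, AMap = \<lambda>(f, g). F\<^sub>1 f \<parallel> F\<^sub>1 g\<rparr>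
     \<lparr>OMap = \<lambda>(a, b). F\<^sub>0 (a \<parallel>\<^sub>0\<^bsub>X\<^esub> b), AMap = \<lambda>(f, g). F\<^sub>1 (f \<parallel>\<^sub>1\<^bsub>X\<^esub> g)\<rparr>
     (\<lambda>(a, b). h a b)"
    by unfold_locales
       (auto simp: prod_cat_def horizontal_simps horizontal_invertible hom_def AMap_Ide
         AMap_Comp_Arr cod.HorA_Comp dom.HorA_Comp[symmetric] h_natural Y.isos_iff)
  then show ?thesis
    using unit_constraint_iso
    by (intro monoidal_functor.intro monoidal_functor_axioms.intro HF.cat_functor_axioms
        X.monoidal_category_axioms Y.monoidal_category_axioms)
       (simp_all add: horizontal_simps horizontal_invertible isos_def AMap_Ide
         h_assoc h_lunit h_runit)
qed

lemma weak_map: "weak_map X Y F v h \<eta>"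
  by (intro weak_map.intro weak_map_axioms.intro dom.dd_Bicats_category_axioms
      cod.dd_Bicats_category_axioms monoidal_functor_axioms horizontal_monoidal_functor
      v_h_interaction)

end

theorem proposition3p6:
  fixes X :: "('o1, 'm1) ddcat" and Y :: "('o2, 'm2) ddcat"
    and F :: "('o1, 'm1, 'o2, 'm2) functor_data"
    and v :: "'o1 \<Rightarrow> 'o1 \<Rightarrow> 'm2" and \<eta> :: "'m2"
  assumes "dd_Bicats_category X"
    and "dd_Bicats_category Y"
    and "monoidal_functor X Y F v \<eta>"
    and braid: "\<And>a b. \<lbrakk>a \<in> Obj X; b \<in> Obj X\<rbrakk> \<Longrightarrow>
           AMap F (braiding X a b) \<cdot>\<^bsub>Y\<^esub> v a b = v b a \<cdot>\<^bsub>Y\<^esub> braiding Y (OMap F a) (OMap F b)"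
  shows "weak_map X Y F v
           (\<lambda>a b. inv_arr Y (AMap F (alpha X a b)) \<cdot>\<^bsub>Y\<^esub> v a b \<cdot>\<^bsub>Y\<^esub> alpha Y (OMap F a) (OMap F b))
           \<eta>"
proof -
  interpret braided_functor X Y F v \<eta>
    using assms by (intro braided_functor.intro braided_functor_axioms.intro)
  show ?thesis
    using weak_map unfolding h_def .
qed

end
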